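(* Let $G$ be a plane graph with the ribbon structure induced by the counter-clockwise orientation of the plane, and fix a starting pair $(x,e)$ where $e=xy$ is an edge. Then the Bernardi map $T\mapsto\beta_{(x,e)}(T)$ is a cycle orientation map; explicitly, it is the cycle orientation map of the configuration in which each cycle $C$ of $G$ is oriented as follows: clockwise if $e$ lies outside $C$; counter-clockwise if $e$ lies inside $C$; and, if $e$ lies on $C$, in the direction opposite to $\overrightarrow{xy}$ (i.e. $C$ traverses $e$ from $y$ to $x$).
   Context: Graphs are finite and connected, possibly with parallel edges but without loops; cycles are simple. A ribbon structure on $G$ is a cyclic ordering of the edges around each vertex; for a plane graph it is induced by the counter-clockwise orientation of the plane. "Inside"/"outside" of a cycle $C$ refer to the bounded/unbounded component of $\mathbb{R}^2\setminus C$. Bernardi process: given a spanning tree $T$ and a starting pair $(v,e)$ with $v$ an endpoint of $e$, produce a sequence of states $(v_0,e_0),(v_1,e_1),\ldots$ with $(v_0,e_0)=(v,e)$; if $e_i\notin T$, set $v_{i+1}=v_i$ and $e_{i+1}$ the edge following $e_i$ in the cyclic order at $v_i$; if $e_i\in T$, let $v_{i+1}$ be the other endpoint of $e_i$ and $e_{i+1}$ the edge following $e_i$ in the cyclic order at $v_{i+1}$; stop when every edge has been traversed exactly twice. For $f\notin T$, let $\eta(f)=v_i$ where $i$ is the first index with $e_i=f$. Then $\beta_{(v,e)}(T)=\sum_{f\notin T}(\eta(f))$, a divisor (formal sum of vertices); equivalently each $f\notin T$ is oriented with head $\eta(f)$. A cycle orientation configuration assigns an orientation to every cycle of $G$; its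 cycle orientation map sends a spanning tree $T$ to the divisor obtained by orienting each edge $f\notin T$ as it is traversed by the (configuration-oriented) unique cycle in $T+f$ and placing one chip at the head of $f$. *)

theory Defs
  imports "HOL-Complex_Analysis.Complex_Analysis" "HOL-Combinatorics.Orbits"
begin

section \<open>Graphs, cycles, spanning trees\<close>

text \<open>Parallel edges are distinct elements of \<open>edges\<close> with equal \<open>ends\<close>.\<close>

record ('v, 'e) ugraph =
  verts :: "'v set"
  edges :: "'e set"
  ends :: "'e \<Rightarrow> 'v set"

definition joined_by :: "('v, 'e) ugraph \<Rightarrow> 'e set \<Rightarrow> bool" where
  "joined_by G F \<longleftrightarrow>
     (\<forall>u\<in>verts G. \<forall>v\<in>verts G. (u, v) \<in> {(a, b). \<exists>e\<in>F. ends G e = {a, b}}\<^sup>*)"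

definition connected_graph :: "('v, 'e) ugraph \<Rightarrow> bool" where
  "connected_graph G \<longleftrightarrow>
     finite (verts G) \<and> finite (edges G) \<and>
     (\<forall>e\<in>edges G. ends G e \<subseteq> verts G \<and> card (ends G e) = 2) \<and>
     verts G \<noteq> {} \<and> joined_by G (edges G)"

definition incident :: "('v, 'e) ugraph \<Rightarrow> 'v \<Rightarrow> 'e set" where
  "incident G v = {e \<in> edges G. v \<in> ends G e}"

definition other_end :: "('v, 'e) ugraph \<Rightarrow> 'e \<Rightarrow> 'v \<Rightarrow> 'v" where
  "other_end G e v = (THE w. ends G e = {v, w})"

text \<open>A dart \<open>(u, e, v)\<close> is the edge \<open>e\<close> traversed from \<open>u\<close> to \<open>v\<close>.\<close>

type_synonym ('v, 'e) dart = "'v \<times> 'e \<times> 'v"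

definition dart_tail :: "('v, 'e) dart \<Rightarrow> 'v" where "dart_tail d = fst d"
definition dart_edge :: "('v, 'e) dart \<Rightarrow> 'e" where "dart_edge d = fst (snd d)"
definition dart_head :: "('v, 'e) dart \<Rightarrow> 'v" where "dart_head d = snd (snd d)"

text \<open>Distinctness of the edges matters only for two darts: it excludes going back and
  forth along one edge, while two parallel edges form a cycle.\<close>

definition cycle_walk :: "('v, 'e) ugraph \<Rightarrow> ('v, 'e) dart list \<Rightarrow> bool" where
  "cycle_walk G ds \<longleftrightarrow>
     2 \<le> length ds \<and>
     (\<forall>d\<in>set ds. dart_edge d \<in> edges G \<and> ends G (dart_edge d) = {dart_tail d, dart_head d}) \<and>
     (\<forall>i<length ds. dart_head (ds ! i) = dart_tail (ds ! (Suc i mod length ds))) \<and>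
     distinct (map dart_tail ds) \<and> distinct (map dart_edge ds)"

text \<open>A cycle is its set of edges, and an orientation of a cycle is the set of darts of a
  cyclic walk around it; neither depends on where the walk starts.\<close>

definition is_cycle :: "('v, 'e) ugraph \<Rightarrow> 'e set \<Rightarrow> bool" where
  "is_cycle G C \<longleftrightarrow> (\<exists>ds. cycle_walk G ds \<and> C = dart_edge ` set ds)"

definition orientation_of ::
  "('v, 'e) ugraph \<Rightarrow> 'e set \<Rightarrow> ('v, 'e) dart set \<Rightarrow> bool" where
  "orientation_of G C D \<longleftrightarrow> (\<exists>ds. cycle_walk G ds \<and> D = set ds \<and> C = dart_edge ` set ds)"

definition spanning_tree :: "('v, 'e) ugraph \<Rightarrow> 'e set \<Rightarrow> bool" where
  "spanning_tree G T \<longleftrightarrow>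
     T \<subseteq> edges G \<and> joined_by G T \<and> (\<forall>C. is_cycle G C \<longrightarrow> \<not> C \<subseteq> T)"

definition fundamental_cycle :: "('v, 'e) ugraph \<Rightarrow> 'e set \<Rightarrow> 'e \<Rightarrow> 'e set" where
  "fundamental_cycle G T f = (THE C. is_cycle G C \<and> C \<subseteq> insert f T)"


section \<open>Divisors and cycle orientation maps\<close>

text \<open>The divisor \<open>\<Sum>f\<in>F. (h f)\<close>.\<close>

definition chips :: "'e set \<Rightarrow> ('e \<Rightarrow> 'v) \<Rightarrow> 'v \<Rightarrow> int" where
  "chips F h = (\<lambda>v. \<Sum>f\<in>F. if h f = v then 1 else 0)"

definition cycle_configuration ::
  "('v, 'e) ugraph \<Rightarrow> ('e set \<Rightarrow> ('v, 'e) dart set) \<Rightarrow> bool" where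
  "cycle_configuration G \<kappa> \<longleftrightarrow> (\<forall>C. is_cycle G C \<longrightarrow> orientation_of G C (\<kappa> C))"

definition head_in :: "('v, 'e) dart set \<Rightarrow> 'e \<Rightarrow> 'v" where
  "head_in D f = (THE w. \<exists>u. (u, f, w) \<in> D)"

definition cycle_orientation_map ::
  "('v, 'e) ugraph \<Rightarrow> ('e set \<Rightarrow> ('v, 'e) dart set) \<Rightarrow> 'e set \<Rightarrow> 'v \<Rightarrow> int" where
  "cycle_orientation_map G \<kappa> T =
     chips (edges G - T) (\<lambda>f. head_in (\<kappa> (fundamental_cycle G T f)) f)"


section \<open>Ribbon structures and the Bernardi process\<close>

text \<open>\<open>\<sigma> v e\<close> is the edge following \<open>e\<close> in the cyclic order at \<open>v\<close>.\<close>

definition ribbon_structure :: "('v, 'e) ugraph \<Rightarrow> ('v \<Rightarrow> 'e \<Rightarrow> 'e) \<Rightarrow> bool" where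
  "ribbon_structure G \<sigma> \<longleftrightarrow>
     (\<forall>v\<in>verts G. incident G v \<noteq> {} \<longrightarrow> cyclic_on (\<sigma> v) (incident G v))"

definition bernardi_step ::
  "('v, 'e) ugraph \<Rightarrow> ('v \<Rightarrow> 'e \<Rightarrow> 'e) \<Rightarrow> 'e set \<Rightarrow> 'v \<times> 'e \<Rightarrow> 'v \<times> 'e" where
  "bernardi_step G \<sigma> T s =
     (let v = fst s; e = snd s; w = (if e \<in> T then other_end G e v else v) in (w, \<sigma> w e))"

definition bernardi_state ::
  "('v, 'e) ugraph \<Rightarrow> ('v \<Rightarrow> 'e \<Rightarrow> 'e) \<Rightarrow> 'v \<times> 'e \<Rightarrow> 'e set \<Rightarrow> nat \<Rightarrow> 'v \<times> 'e" where
  "bernardi_state G \<sigma> s T i = (bernardi_step G \<sigma> T ^^ i) s"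

text \<open>The process stops before state \<open>n\<close> if the states \<open>0, \<dots>, n - 1\<close> have traversed
  every edge exactly twice; state \<open>i\<close> is reached if it did not stop before any state up to \<open>i\<close>.\<close>

definition bernardi_reached ::
  "('v, 'e) ugraph \<Rightarrow> ('v \<Rightarrow> 'e \<Rightarrow> 'e) \<Rightarrow> 'v \<times> 'e \<Rightarrow> 'e set \<Rightarrow> nat \<Rightarrow> bool" where
  "bernardi_reached G \<sigma> s T i \<longleftrightarrow>
     (\<forall>n\<le>i. \<not> (\<forall>f\<in>edges G. card {j. j < n \<and> snd (bernardi_state G \<sigma> s T j) = f} = 2))"

definition bernardi_head ::
  "('v, 'e) ugraph \<Rightarrow> ('v \<Rightarrow> 'e \<Rightarrow> 'e) \<Rightarrow> 'v \<times> 'e \<Rightarrow> 'e set \<Rightarrow> 'e \<Rightarrow> 'v" where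
  "bernardi_head G \<sigma> s T f =
     fst (bernardi_state G \<sigma> s T
       (LEAST i. bernardi_reached G \<sigma> s T i \<and> snd (bernardi_state G \<sigma> s T i) = f))"

definition bernardi_map ::
  "('v, 'e) ugraph \<Rightarrow> ('v \<Rightarrow> 'e \<Rightarrow> 'e) \<Rightarrow> 'v \<times> 'e \<Rightarrow> 'e set \<Rightarrow> 'v \<Rightarrow> int" where
  "bernardi_map G \<sigma> s T = chips (edges G - T) (bernardi_head G \<sigma> s T)"


section \<open>Plane graphs\<close>

text \<open>Vertices are points of the plane, and \<open>\<gamma> e\<close> is a parametrization (in either
  direction) of the arc that is the edge \<open>e\<close>.\<close>

definition plane_graph :: "(complex, 'e) ugraph \<Rightarrow> ('e \<Rightarrow> real \<Rightarrow> complex) \<Rightarrow> bool" where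
  "plane_graph G \<gamma> \<longleftrightarrow>
     connected_graph G \<and>
     (\<forall>e\<in>edges G. arc (\<gamma> e) \<and> ends G e = {pathstart (\<gamma> e), pathfinish (\<gamma> e)} \<and>
        path_image (\<gamma> e) \<inter> verts G = ends G e) \<and>
     (\<forall>e\<in>edges G. \<forall>f\<in>edges G. e \<noteq> f \<longrightarrow>
        path_image (\<gamma> e) \<inter> path_image (\<gamma> f) \<subseteq> verts G)"

definition curve_from :: "('e \<Rightarrow> real \<Rightarrow> complex) \<Rightarrow> complex \<Rightarrow> 'e \<Rightarrow> real \<Rightarrow> complex" where
  "curve_from \<gamma> v e = (if pathstart (\<gamma> e) = v then \<gamma> e else reversepath (\<gamma> e))"

text \<open>The first point at distance \<open>r\<close> from \<open>v\<close> met when leaving \<open>v\<close> along \<open>e\<close>.\<close>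

definition exit_point ::
  "('e \<Rightarrow> real \<Rightarrow> complex) \<Rightarrow> complex \<Rightarrow> real \<Rightarrow> 'e \<Rightarrow> complex" where
  "exit_point \<gamma> v r e =
     curve_from \<gamma> v e (Inf {t \<in> {0..1}. dist v (curve_from \<gamma> v e t) = r})"

text \<open>The counter-clockwise angle, in \<open>[0, 2\<pi>)\<close>, from \<open>p\<close> to \<open>q\<close> as seen from \<open>v\<close>.\<close>

definition ccw_angle :: "complex \<Rightarrow> complex \<Rightarrow> complex \<Rightarrow> real" where
  "ccw_angle v p q = Arg2pi ((q - v) / (p - v))"

text \<open>Edges are arbitrary arcs and need not have a tangent direction at \<open>v\<close>, so their
  counter-clockwise order at \<open>v\<close> is read off from the points where they first leave a small disc
  around \<open>v\<close>. This order is the same for all sufficiently small radii: if the circle of radius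
  \<open>R\<close> about \<open>v\<close> is met by all edges at \<open>v\<close>, then for \<open>r < R\<close> the initial pieces of the edges up
  to the two circles form two stars, one inside the other, with the same orientation.
  Among the edges at \<open>v\<close> other than \<open>e\<close>, the one following \<open>e\<close> is at the least
  counter-clockwise angle from \<open>e\<close>; that \<open>\<sigma> v e \<noteq> e\<close> if there are such edges is part of
  \<open>ribbon_structure\<close>.\<close>

definition ccw_ribbon_structure ::
  "(complex, 'e) ugraph \<Rightarrow> ('e \<Rightarrow> real \<Rightarrow> complex) \<Rightarrow> (complex \<Rightarrow> 'e \<Rightarrow> 'e) \<Rightarrow> bool" where
  "ccw_ribbon_structure G \<gamma> \<sigma> \<longleftrightarrow>
     ribbon_structure G \<sigma> \<and>
     (\<forall>v\<in>verts G. \<forall>\<^sub>F r in at_right 0. \<forall>e\<in>incident G v. \<forall>f\<in>incident G v - {e}.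
        ccw_angle v (exit_point \<gamma> v r e) (exit_point \<gamma> v r (\<sigma> v e))
          \<le> ccw_angle v (exit_point \<gamma> v r e) (exit_point \<gamma> v r f))"

definition cycle_image :: "('e \<Rightarrow> real \<Rightarrow> complex) \<Rightarrow> 'e set \<Rightarrow> complex set" where
  "cycle_image \<gamma> C = (\<Union>c\<in>C. path_image (\<gamma> c))"

text \<open>For \<open>S\<close> a Jordan curve, \<^term>\<open>inside S\<close> and \<^term>\<open>outside S\<close> are the bounded and the
  unbounded component of its complement.\<close>

definition lies_inside :: "('e \<Rightarrow> real \<Rightarrow> complex) \<Rightarrow> 'e \<Rightarrow> 'e set \<Rightarrow> bool" where
  "lies_inside \<gamma> e C \<longleftrightarrow> \<gamma> e ` {0<..<1} \<subseteq> inside (cycle_image \<gamma> C)"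

definition lies_outside :: "('e \<Rightarrow> real \<Rightarrow> complex) \<Rightarrow> 'e \<Rightarrow> 'e set \<Rightarrow> bool" where
  "lies_outside \<gamma> e C \<longleftrightarrow> \<gamma> e ` {0<..<1} \<subseteq> outside (cycle_image \<gamma> C)"

fun walk_path ::
  "('e \<Rightarrow> real \<Rightarrow> complex) \<Rightarrow> (complex, 'e) dart list \<Rightarrow> real \<Rightarrow> complex" where
  "walk_path \<gamma> [] = linepath 0 0"
| "walk_path \<gamma> [d] = curve_from \<gamma> (dart_tail d) (dart_edge d)"
| "walk_path \<gamma> (d # d' # ds) =
     curve_from \<gamma> (dart_tail d) (dart_edge d) +++ walk_path \<gamma> (d' # ds)"

definition counter_clockwise ::
  "(complex, 'e) ugraph \<Rightarrow> ('e \<Rightarrow> real \<Rightarrow> complex) \<Rightarrow> (complex, 'e) dart set \<Rightarrow> bool" where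
  "counter_clockwise G \<gamma> D \<longleftrightarrow>
     (\<exists>ds. cycle_walk G ds \<and> set ds = D \<and>
        (\<forall>z\<in>inside (path_image (walk_path \<gamma> ds)). winding_number (walk_path \<gamma> ds) z = 1))"

definition clockwise ::
  "(complex, 'e) ugraph \<Rightarrow> ('e \<Rightarrow> real \<Rightarrow> complex) \<Rightarrow> (complex, 'e) dart set \<Rightarrow> bool" where
  "clockwise G \<gamma> D \<longleftrightarrow>
     (\<exists>ds. cycle_walk G ds \<and> set ds = D \<and>
        (\<forall>z\<in>inside (path_image (walk_path \<gamma> ds)). winding_number (walk_path \<gamma> ds) z = - 1))"

end

theory Submission
  imports Defs
begin

text \<open>
  Let \<open>C\<close> be the fundamental cycle of \<open>f\<close>, oriented such that the starting half-edge \<open>(x, e)\<close> lies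
  to its left or \<open>e\<close> is the edge of \<open>C\<close> that enters \<open>x\<close>; this is the orientation prescribed by the
  theorem. As \<open>C - {f}\<close> lies in the tree, the Bernardi tour cannot cross \<open>C\<close> before it meets \<open>f\<close>: it
  only visits half-edges to the left of \<open>C\<close> and half-edges \<open>(v, a)\<close> with \<open>a\<close> the edge of \<open>C\<close> entering \<open>v\<close>.
  Hence it meets \<open>f\<close> first at the head of \<open>f\<close>. It does meet \<open>f\<close>, because for a spanning tree the
  tour visits all half-edges.

  The invariance rests on the fact that the edges leaving \<open>C\<close> at \<open>v\<close> between the outgoing and the
  incoming edge, in counter-clockwise order, lie to the left of \<open>C\<close>. Edges are mere arcs, so this is
  a comparison of winding numbers: inside a small disc about \<open>v\<close>, replace the crosscut formed by
  \<open>C\<close> by either of the two arcs of the circle with the same ends.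
\<close>

section \<open>Walks and fundamental cycles\<close>

text \<open>An arc may spiral around \<open>v\<close> and cross a circle about \<open>v\<close>
  infinitely often, so the edges as a whole do not cut a small disc into sectors. Only their initial
  pieces, up to the first exit from the disc, form a star. The rest of the cycle may come back into
  the disc and enters the argument through one winding number, which is constant only on a second,
  smaller disc about \<open>v\<close>. This leaves two values \<open>K\<close> and
  \<open>K - 1\<close> for the winding number of the cycle near \<open>v\<close>, with
  \<open>K\<close> on the left of the crosscut. By the Jordan curve theorem there are inside and
  outside points arbitrarily close to \<open>v\<close>. Outside points have winding number 0 and
  inside points 1 or -1 according to the orientation, and this fixes \<open>K\<close>. So a local
  left is matched with a global one. The right-hand sector is treated by the same lemma for the
  reversed walk. It is needed for a converse: an edge known to lie on the left must start in the
  left-hand sector, and only then can the next edge in counter-clockwise order be located.\<close>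

definition linked :: "('v, 'e) ugraph \<Rightarrow> 'e set \<Rightarrow> ('v \<times> 'v) set" where
  "linked G F = {(a, b). \<exists>e\<in>F. ends G e = {a, b}}\<^sup>*"

lemma joined_by_linked: "joined_by G F \<longleftrightarrow> (\<forall>u\<in>verts G. \<forall>v\<in>verts G. (u, v) \<in> linked G F)"
  by (simp add: joined_by_def linked_def)

lemma linked_refl [simp]: "(u, u) \<in> linked G F"
  by (simp add: linked_def)

lemma linked_trans: "(u, v) \<in> linked G F \<Longrightarrow> (v, w) \<in> linked G F \<Longrightarrow> (u, w) \<in> linked G F"
  unfolding linked_def by (rule rtrancl_trans)

lemma linked_sym: "(u, v) \<in> linked G F \<Longrightarrow> (v, u) \<in> linked G F"
proof -
  have "sym {(a, b). \<exists>e\<in>F. ends G e = {a, b}}"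
    by (auto simp: sym_def insert_commute)
  then show "(u, v) \<in> linked G F \<Longrightarrow> (v, u) \<in> linked G F"
    unfolding linked_def by (meson sym_rtrancl symD)
qed

lemma linked_edge: "e \<in> F \<Longrightarrow> ends G e = {a, b} \<Longrightarrow> (a, b) \<in> linked G F"
  unfolding linked_def by blast

text \<open>Rerouting: the detours that replace the single edges concatenate. Used to push a
  connection along a cycle into a set that lacks one of its edges.\<close>

lemma linked_least:
  assumes "(u, w) \<in> linked G F"
    and "\<And>e a b. e \<in> F \<Longrightarrow> ends G e = {a, b} \<Longrightarrow> (a, b) \<in> linked G F'"
  shows "(u, w) \<in> linked G F'"
  using assms(1) unfolding linked_def[of G F]
proof (induction rule: rtrancl_induct)
  case (step y z)
  then have "(y, z) \<in> linked G F'" using assms(2) by blast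
  then show ?case by (rule linked_trans[OF step.IH])
qed simp

lemma linked_mono: "(u, w) \<in> linked G F \<Longrightarrow> F \<subseteq> F' \<Longrightarrow> (u, w) \<in> linked G F'"
  by (erule linked_least) (auto intro: linked_edge)

text \<open>Of a connection through \<open>h\<close> only the stretches before the first and after
  the last passage matter, and these avoid \<open>h\<close>. If they end and begin at the same end
  of \<open>h\<close>, they join up without it.\<close>

lemma linked_insert:
  assumes "(u, w) \<in> linked G (insert h F)" "ends G h = {p, q}"
  shows "(u, w) \<in> linked G F \<or> (u, p) \<in> linked G F \<and> (q, w) \<in> linked G F
    \<or> (u, q) \<in> linked G F \<and> (p, w) \<in> linked G F"
  using assms(1) unfolding linked_def[of G "insert h F"]
proof (induction rule: rtrancl_induct)
  case (step y z)
  then consider "ends G h = {y, z}" | e where "e \<in> F" "ends G e = {y, z}" by auto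
  then show ?case
  proof cases
    case 1
    then have "y = p \<and> z = q \<or> y = q \<and> z = p" using assms(2) by (auto simp: doubleton_eq_iff)
    then show ?thesis using step.IH by (metis linked_refl linked_trans linked_sym)
  next
    case 2
    then have "(y, z) \<in> linked G F" by (rule linked_edge)
    then show ?thesis using step.IH by (metis linked_trans)
  qed
qed simp

section \<open>Walks as lists of darts, and simple closed walks\<close>

lemma dart_simps:
  "dart_tail (a, e, b) = a" "dart_edge (a, e, b) = e" "dart_head (a, e, b) = b"
  by (simp_all add: dart_tail_def dart_edge_def dart_head_def)

text \<open>Carrying both end vertices makes concatenation and reversal structural inductions, which
  the cyclic indexing in \<open>cycle_walk\<close> does not allow; \<open>cycle_walk_iff\<close>
  translates.\<close>

fun dart_walk :: "('v, 'e) ugraph \<Rightarrow> 'v \<Rightarrow> ('v, 'e) dart list \<Rightarrow> 'v \<Rightarrow> bool" where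
  "dart_walk G u [] w \<longleftrightarrow> u = w"
| "dart_walk G u ((a, e, b) # ds) w \<longleftrightarrow>
     a = u \<and> e \<in> edges G \<and> ends G e = {a, b} \<and> dart_walk G b ds w"

lemma dart_walk_append:
  "dart_walk G u (xs @ ys) w \<longleftrightarrow> (\<exists>v. dart_walk G u xs v \<and> dart_walk G v ys w)"
  by (induction G u xs w rule: dart_walk.induct) auto

text \<open>The vertex sequence, read off the tails and off the heads. For a closed walk this makes
  the heads a permutation of the tails.\<close>

lemma dart_walk_verts:
  "dart_walk G u ds w \<Longrightarrow> map dart_tail ds @ [w] = u # map dart_head ds"
  by (induction G u ds w rule: dart_walk.induct) (auto simp: dart_simps)

lemma dart_walk_valid:
  "dart_walk G u ds w \<Longrightarrow> (a, e, b) \<in> set ds \<Longrightarrow> e \<in> edges G \<and> ends G e = {a, b}"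
  by (induction G u ds w rule: dart_walk.induct) auto

lemma dart_walk_linked:
  "dart_walk G u ds w \<Longrightarrow> dart_edge ` set ds \<subseteq> F \<Longrightarrow> (u, w) \<in> linked G F"
proof (induction G u ds w rule: dart_walk.induct)
  case (2 G u a e b ds w)
  then have "(a, b) \<in> linked G F" "(b, w) \<in> linked G F"
    by (auto simp: dart_simps intro: linked_edge)
  then show ?case using 2 by (auto intro: linked_trans)
qed simp

text \<open>Distinctness is kept while the walk grows at its front: if the new first vertex already
  occurs, everything before that occurrence is discarded.\<close>

lemma linked_dart_walk:
  assumes "(u, w) \<in> linked G F" "F \<subseteq> edges G"
  obtains ds where "dart_walk G u ds w" "dart_edge ` set ds \<subseteq> F" "distinct (map dart_tail ds @ [w])"
proof -
  have "\<exists>ds. dart_walk G u ds w \<and> dart_edge ` set ds \<subseteq> F \<and> distinct (map dart_tail ds @ [w])"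
    using assms(1) unfolding linked_def
  proof (induction rule: converse_rtrancl_induct)
    case base
    show ?case by (rule exI[of _ "[]"]) simp
  next
    case (step y z)
    then obtain e ds where e: "e \<in> F" "ends G e = {y, z}" and ds: "dart_walk G z ds w"
      "dart_edge ` set ds \<subseteq> F" "distinct (map dart_tail ds @ [w])" by auto
    consider "y = w" | d where "y \<noteq> w" "d \<in> set ds" "dart_tail d = y"
      | "y \<noteq> w" "y \<notin> dart_tail ` set ds" by blast
    then show ?case
    proof cases
      case 1
      then show ?thesis by (intro exI[of _ "[]"]) simp
    next
      case 2
      then obtain xs ys where xy: "ds = xs @ d # ys" by (meson split_list)
      then have "dart_walk G y (d # ys) w"
        using ds(1) 2(3) by (cases d) (auto simp: dart_walk_append dart_simps)
      then show ?thesis using ds xy by (intro exI[of _ "d # ys"]) auto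
    next
      case 3
      then show ?thesis using e ds assms(2)
        by (intro exI[of _ "(y, e, z) # ds"]) (auto simp: dart_simps)
    qed
  qed
  then show ?thesis using that by blast
qed

text \<open>If the first edge occurred again, both of its ends, and so the first vertex, would occur
  among the later vertices.\<close>

lemma dart_walk_distinct_edges:
  "dart_walk G u ds w \<Longrightarrow> distinct (map dart_tail ds @ [w]) \<Longrightarrow> distinct (map dart_edge ds)"
proof (induction G u ds w rule: dart_walk.induct)
  case (2 G u a e b ds w)
  have "dart_edge d \<noteq> e" if d: "d \<in> set ds" for d
  proof
    obtain a' e' b' where d': "d = (a', e', b')" by (cases d)
    assume "dart_edge d = e"
    then have "{a, b} = {a', b'}" using 2(2) d d' dart_walk_valid[of G b ds w a' e' b']
      by (auto simp: dart_simps)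
    moreover have "a' \<in> set (map dart_tail ds)" using d d' by (force simp: dart_simps)
    moreover have "b' \<in> set (map dart_head ds)" using d d' by (force simp: dart_simps)
    then have "b' \<in> set (map dart_tail ds @ [w])" using dart_walk_verts[of G b ds w] 2(2) by auto
    ultimately show False using 2(3) by (auto simp: dart_simps doubleton_eq_iff)
  qed
  then show ?case using 2 by (force simp: dart_simps)
qed simp

definition reverse_walk :: "('v, 'e) dart list \<Rightarrow> ('v, 'e) dart list" where
  "reverse_walk ds = rev (map (\<lambda>(a, e, b). (b, e, a)) ds)"

lemma dart_walk_reverse: "dart_walk G u ds w \<Longrightarrow> dart_walk G w (reverse_walk ds) u"
  unfolding reverse_walk_def
  by (induction G u ds w rule: dart_walk.induct) (auto simp: dart_walk_append insert_commute)

lemma set_reverse_walk: "set (reverse_walk ds) = (\<lambda>(a, e, b). (b, e, a)) ` set ds"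
  by (simp add: reverse_walk_def)

lemma dart_in_reverse_walk: "(b, g, a) \<in> set (reverse_walk ds) \<longleftrightarrow> (a, g, b) \<in> set ds"
proof
  assume "(b, g, a) \<in> set (reverse_walk ds)"
  then show "(a, g, b) \<in> set ds" by (auto simp: set_reverse_walk)
next
  assume "(a, g, b) \<in> set ds"
  then show "(b, g, a) \<in> set (reverse_walk ds)"
    unfolding set_reverse_walk by (rule rev_image_eqI) simp
qed

lemma edges_reverse_walk: "dart_edge ` set (reverse_walk ds) = dart_edge ` set ds"
proof -
  have "dart_edge (case d of (a, e, b) \<Rightarrow> (b, e, a)) = dart_edge d" for d :: "('v, 'e) dart"
    by (cases d) (simp add: dart_simps)
  then show ?thesis unfolding set_reverse_walk image_image by (intro image_cong) auto
qed

lemma edge_of_dart_iff: "f \<in> dart_edge ` set ds \<longleftrightarrow> (\<exists>a b. (a, f, b) \<in> set ds)"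
proof
  assume "f \<in> dart_edge ` set ds"
  then obtain d where d: "d \<in> set ds" "f = dart_edge d" by auto
  then have "(fst d, f, snd (snd d)) \<in> set ds" by (simp add: dart_edge_def)
  then show "\<exists>a b. (a, f, b) \<in> set ds" by blast
next
  assume "\<exists>a b. (a, f, b) \<in> set ds"
  then obtain a b where ab: "(a, f, b) \<in> set ds" by blast
  show "f \<in> dart_edge ` set ds" using imageI[OF ab, of dart_edge] by (simp add: dart_simps)
qed

lemma dart_walk_iff_nth:
  "ds \<noteq> [] \<Longrightarrow> dart_walk G u ds w \<longleftrightarrow>
     (\<forall>d\<in>set ds. dart_edge d \<in> edges G \<and> ends G (dart_edge d) = {dart_tail d, dart_head d}) \<and>
     (\<forall>i. Suc i < length ds \<longrightarrow> dart_head (ds ! i) = dart_tail (ds ! Suc i)) \<and>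
     dart_tail (ds ! 0) = u \<and> dart_head (ds ! (length ds - 1)) = w"
proof (induction G u ds w rule: dart_walk.induct)
  case (2 G u a e b ds w)
  show ?case
  proof (cases "ds = []")
    case False
    have "(\<forall>i. Suc i < length ((a, e, b) # ds) \<longrightarrow>
        dart_head (((a, e, b) # ds) ! i) = dart_tail (((a, e, b) # ds) ! Suc i)) \<longleftrightarrow>
      b = dart_tail (ds ! 0) \<and> (\<forall>i. Suc i < length ds \<longrightarrow> dart_head (ds ! i) = dart_tail (ds ! Suc i))"
      (is "?L \<longleftrightarrow> ?R")
    proof
      assume L: ?L
      have "b = dart_tail (ds ! 0)" using L[rule_format, of 0] False by (simp add: dart_simps)
      moreover have "dart_head (ds ! i) = dart_tail (ds ! Suc i)" if "Suc i < length ds" for i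
        using L[rule_format, of "Suc i"] that by simp
      ultimately show ?R by blast
    next
      assume ?R
      then show ?L by (auto simp: nth_Cons dart_simps split: nat.split)
    qed
    then show ?thesis using 2 False by (auto simp: dart_simps)
  qed (auto simp: dart_simps)
qed simp

lemma cycle_walk_iff:
  "cycle_walk G ds \<longleftrightarrow> 2 \<le> length ds \<and> (\<exists>u. dart_walk G u ds u) \<and>
     distinct (map dart_tail ds) \<and> distinct (map dart_edge ds)"
proof (cases "2 \<le> length ds")
  case True
  then have ne: "ds \<noteq> []" by auto
  have "(\<forall>i<length ds. dart_head (ds ! i) = dart_tail (ds ! (Suc i mod length ds))) \<longleftrightarrow>
     (\<forall>i. Suc i < length ds \<longrightarrow> dart_head (ds ! i) = dart_tail (ds ! Suc i)) \<and>
     dart_head (ds ! (length ds - 1)) = dart_tail (ds ! 0)" (is "?L \<longleftrightarrow> ?R")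
  proof
    assume L: ?L
    show ?R using L[rule_format, of "length ds - 1"] L ne by auto
  next
    assume R: ?R
    show ?L
    proof (intro allI impI)
      fix i assume i: "i < length ds"
      then consider "Suc i < length ds" | "i = length ds - 1" by linarith
      then show "dart_head (ds ! i) = dart_tail (ds ! (Suc i mod length ds))"
        using R ne by cases auto
    qed
  qed
  then show ?thesis
    unfolding cycle_walk_def using dart_walk_iff_nth[OF ne] by auto
qed (simp add: cycle_walk_def)

lemma cycle_walk_rotate:
  assumes "cycle_walk G (xs @ ys)"
  shows "cycle_walk G (ys @ xs)"
  using assms unfolding cycle_walk_iff by (auto simp: dart_walk_append)

lemma cycle_walk_reverse:
  assumes "cycle_walk G ds"
  shows "cycle_walk G (reverse_walk ds)"
proof -
  obtain u where u: "dart_walk G u ds u" and d: "distinct (map dart_tail ds)"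
    "distinct (map dart_edge ds)" "2 \<le> length ds"
    using assms by (auto simp: cycle_walk_iff)
  \<comment> \<open>The tails of the reversed walk are the heads of the original one, so their
    distinctness has to come from that of the tails; cancelling the closing vertex \<open>u\<close>
    gives equal multisets.\<close>
  have "mset (map dart_tail ds) + {#u#} = {#u#} + mset (map dart_head ds)"
    using dart_walk_verts[OF u] by (metis add_mset_add_single mset.simps(2) mset_append
        add.commute mset.simps(1) add_mset_commute union_mset_add_mset_left add_0)
  then have "mset (map dart_tail ds) = mset (map dart_head ds)" by simp
  then have "distinct (map dart_head ds)"
    using d(1) by (metis mset_eq_imp_distinct_iff)
  moreover have "map dart_tail (reverse_walk ds) = rev (map dart_head ds)"
    "map dart_edge (reverse_walk ds) = rev (map dart_edge ds)"
    "length (reverse_walk ds) = length ds"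
    by (auto simp: reverse_walk_def dart_tail_def dart_edge_def dart_head_def rev_map)
  ultimately show ?thesis
    using dart_walk_reverse[OF u] d unfolding cycle_walk_iff by auto
qed

lemma cycle_walk_from:
  assumes "cycle_walk G ds" "d \<in> set ds"
  obtains ys where "cycle_walk G (d # ys)" "set (d # ys) = set ds"
proof -
  obtain xs zs where "ds = xs @ (d # zs)" using assms(2) by (meson split_list)
  then show ?thesis using assms(1) that[of "zs @ xs"] cycle_walk_rotate[of G xs "d # zs"] by auto
qed

section \<open>Cycles against connections, and the uniqueness of fundamental cycles\<close>

lemma cycle_linked:
  assumes "is_cycle G C" "h \<in> C" "ends G h = {p, q}"
  shows "(p, q) \<in> linked G (C - {h})"
proof -
  obtain ds d where ds: "cycle_walk G ds" "C = dart_edge ` set ds" "d \<in> set ds" "dart_edge d = h"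
    using assms by (auto simp: is_cycle_def)
  obtain ys where ys: "cycle_walk G (d # ys)" "set (d # ys) = set ds"
    by (rule cycle_walk_from[OF ds(1,3)])
  obtain a b where d: "d = (a, h, b)" using ds(4) by (cases d) (auto simp: dart_simps)
  have w: "dart_walk G b ys a" "ends G h = {a, b}" and dist: "h \<notin> dart_edge ` set ys"
    using ys(1) d by (auto simp: cycle_walk_iff dart_simps)
  have "C = dart_edge ` set (d # ys)" using ys(2) ds(2) by simp
  then have "dart_edge ` set ys \<subseteq> C - {h}" using dist by auto
  then have "(b, a) \<in> linked G (C - {h})" by (rule dart_walk_linked[OF w(1)])
  moreover have "p = a \<and> q = b \<or> p = b \<and> q = a" using w assms(3) by (auto simp: doubleton_eq_iff)
  ultimately show ?thesis using linked_sym by metis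
qed

lemma linked_cycle:
  assumes "F \<subseteq> edges G" "f \<in> edges G" "f \<notin> F" "ends G f = {u, w}" "u \<noteq> w" "(u, w) \<in> linked G F"
  obtains C where "is_cycle G C" "f \<in> C" "C \<subseteq> insert f F"
proof -
  obtain ds where ds: "dart_walk G u ds w" "dart_edge ` set ds \<subseteq> F" "distinct (map dart_tail ds @ [w])"
    using linked_dart_walk assms by metis
  have "ds \<noteq> []" using ds(1) assms(5) by auto
  then have "cycle_walk G ((w, f, u) # ds)"
    using ds assms dart_walk_distinct_edges[OF ds(1,3)]
    by (cases ds) (auto simp: cycle_walk_iff dart_simps insert_commute)
  then have "is_cycle G (dart_edge ` set ((w, f, u) # ds))" unfolding is_cycle_def by blast
  then show ?thesis using ds(2) by (intro that) (auto simp: dart_simps)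
qed

lemma connected_graph_ends:
  assumes "connected_graph G" "f \<in> edges G"
  obtains u w where "ends G f = {u, w}" "u \<noteq> w" "u \<in> verts G" "w \<in> verts G"
proof -
  have "card (ends G f) = 2" "ends G f \<subseteq> verts G" using assms by (auto simp: connected_graph_def)
  then show ?thesis using that by (auto simp: card_2_iff)
qed

text \<open>As \<open>fundamental_cycle\<close> is a definite description, uniqueness must be shown.
  The fact \<open>char\<close> gives it at once: the tree edges of the cycle are those whose
  deletion separates the ends of \<open>f\<close> in the tree, a description that does not mention
  the cycle.\<close>

lemma fundamental_cycle:
  assumes G: "connected_graph G" and T: "spanning_tree G T" and f: "f \<in> edges G - T"
  shows "is_cycle G (fundamental_cycle G T f)" "f \<in> fundamental_cycle G T f"
    "fundamental_cycle G T f \<subseteq> insert f T"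
proof -
  obtain u w where uw: "ends G f = {u, w}" "u \<noteq> w" "u \<in> verts G" "w \<in> verts G"
    using connected_graph_ends[OF G] f by (metis DiffD1)
  have TE: "T \<subseteq> edges G" and acyclic: "\<And>C. is_cycle G C \<Longrightarrow> \<not> C \<subseteq> T"
    and uwT: "(u, w) \<in> linked G T"
    using T uw by (auto simp: spanning_tree_def joined_by_linked)
  have tree_cut: "(p, q) \<notin> linked G (T - {h})" if h: "h \<in> T" and pq: "ends G h = {p, q}" for h p q
  proof
    assume *: "(p, q) \<in> linked G (T - {h})"
    have "h \<in> edges G" using h TE by auto
    then have "p \<noteq> q"
      by (rule connected_graph_ends[OF G]) (use pq in \<open>auto simp: doubleton_eq_iff\<close>)
    have "T - {h} \<subseteq> edges G" "h \<notin> T - {h}" using TE by auto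
    then obtain C where C: "is_cycle G C" "C \<subseteq> insert h (T - {h})"
      using linked_cycle[of "T - {h}" G h p q] \<open>h \<in> edges G\<close> pq \<open>p \<noteq> q\<close> * by metis
    then have "C \<subseteq> T" using h by auto
    then show False using acyclic[OF C(1)] by simp
  qed
  have char: "C = insert f {h \<in> T. (u, w) \<notin> linked G (T - {h})}"
    if C: "is_cycle G C" "C \<subseteq> insert f T" for C
  proof -
    have fC: "f \<in> C" using acyclic C by blast
    have "h \<in> C \<longleftrightarrow> (u, w) \<notin> linked G (T - {h})" if h: "h \<in> T" for h
    proof
      assume hC: "h \<in> C"
      have "h \<in> edges G" using h TE by auto
      then obtain p q where pq: "ends G h = {p, q}" by (rule connected_graph_ends[OF G])
      show "(u, w) \<notin> linked G (T - {h})"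
      proof
        assume *: "(u, w) \<in> linked G (T - {h})"
        \<comment> \<open>The cycle connects the ends of \<open>h\<close> without \<open>h\<close>.
          If the ends of \<open>f\<close> were still connected in \<open>T - {h}\<close>, its
          passage through \<open>f\<close> could be rerouted there, and \<open>h\<close> would close
          a cycle in the tree.\<close>
        have "(p, q) \<in> linked G (C - {h})" by (rule cycle_linked[OF C(1) hC pq])
        then have "(p, q) \<in> linked G (T - {h})"
        proof (rule linked_least)
          fix g a b assume g: "g \<in> C - {h}" "ends G g = {a, b}"
          show "(a, b) \<in> linked G (T - {h})"
          proof (cases "g = f")
            case True
            then have "a = u \<and> b = w \<or> a = w \<and> b = u" using g uw by (auto simp: doubleton_eq_iff)
            then show ?thesis using * linked_sym by metis
          next
            case False
            then show ?thesis using g C by (intro linked_edge[of g]) auto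
          qed
        qed
        then show False using tree_cut[OF h pq] by simp
      qed
    next
      assume *: "(u, w) \<notin> linked G (T - {h})"
      show "h \<in> C"
      proof (rule ccontr)
        assume "h \<notin> C"
        then have "C - {f} \<subseteq> T - {h}" using C by auto
        moreover have "(u, w) \<in> linked G (C - {f})" by (rule cycle_linked[OF C(1) fC uw(1)])
        ultimately show False using * linked_mono[of u w G "C - {f}" "T - {h}"] by simp
      qed
    qed
    then show ?thesis using C(2) fC by auto
  qed
  obtain C where C: "is_cycle G C" "f \<in> C" "C \<subseteq> insert f T"
    by (rule linked_cycle[OF TE _ _ uw(1,2) uwT]) (use f in auto)
  have "fundamental_cycle G T f = C"
    unfolding fundamental_cycle_def
    using C(1,3) char[OF C(1,3)] char by (intro the_equality conjI) metis+
  with C show "is_cycle G (fundamental_cycle G T f)" "f \<in> fundamental_cycle G T f"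
    "fundamental_cycle G T f \<subseteq> insert f T" by auto
qed


section \<open>The Bernardi tour of a spanning tree\<close>

definition reaches :: "('a \<Rightarrow> 'a) \<Rightarrow> 'a \<Rightarrow> 'a \<Rightarrow> bool" where
  "reaches \<pi> s t \<longleftrightarrow> (\<exists>n. (\<pi> ^^ n) s = t)"

lemma reaches_refl [simp]: "reaches \<pi> s s"
  unfolding reaches_def by (rule exI[of _ 0]) simp

lemma reaches_trans: "reaches \<pi> s t \<Longrightarrow> reaches \<pi> t u \<Longrightarrow> reaches \<pi> s u"
  unfolding reaches_def by (metis funpow_add o_apply)

lemma reaches_step: "reaches \<pi> s (\<pi> s)"
  unfolding reaches_def by (rule exI[of _ 1]) simp

lemma reaches_induct [consumes 1, case_names refl step]:
  assumes "reaches \<pi> s t" "P s" "\<And>t. reaches \<pi> s t \<Longrightarrow> P t \<Longrightarrow> P (\<pi> t)"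
  shows "P t"
proof -
  have "P ((\<pi> ^^ n) s)" for n
    by (induction n) (use assms(2,3) in \<open>auto simp: reaches_def\<close>)
  then show ?thesis using assms(1) by (auto simp: reaches_def)
qed

text \<open>Both maps trace the same orbit until it arrives at \<open>a\<close> or
  \<open>b\<close>.\<close>

lemma reaches_until:
  assumes "reaches \<pi> s t" and eq: "\<And>s. s \<noteq> a \<Longrightarrow> s \<noteq> b \<Longrightarrow> \<pi>' s = \<pi> s"
  shows "reaches \<pi>' s t \<or> reaches \<pi> s a \<and> reaches \<pi>' s a \<or> reaches \<pi> s b \<and> reaches \<pi>' s b"
  using assms(1)
proof (induction rule: reaches_induct)
  case (step t)
  show ?case
  proof (cases "t = a \<or> t = b")
    case True
    then show ?thesis using step by blast
  next
    case False
    then have "\<pi>' t = \<pi> t" using eq by blast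
    then show ?thesis using step.IH reaches_step[of \<pi>' t] reaches_trans[of \<pi>' s t] by metis
  qed
qed simp

text \<open>After its first step from \<open>a\<close>, the map \<open>\<pi>'\<close> follows the
  \<open>\<pi>\<close>-orbit of \<open>b\<close>, which never meets \<open>a\<close>. When that
  orbit returns to \<open>b\<close>, its next point \<open>\<pi> b\<close> is the one with which it
  began, so it is reached anyway.\<close>

lemma reaches_swap:
  assumes eq: "\<And>s. s \<noteq> a \<Longrightarrow> s \<noteq> b \<Longrightarrow> \<pi>' s = \<pi> s" and ab: "\<pi>' a = \<pi> b"
    and "\<not> reaches \<pi> (\<pi> b) a" and "reaches \<pi> (\<pi> b) t"
  shows "reaches \<pi>' a t"
  using assms(4)
proof (induction rule: reaches_induct)
  case refl
  then show ?case using ab reaches_step by metis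
next
  case (step t)
  show ?case
  proof (cases "t = b")
    case True
    then show ?thesis using ab reaches_step by metis
  next
    case False
    then have "\<pi>' t = \<pi> t" using eq step.hyps assms(3) by metis
    then show ?thesis using step.IH by (metis reaches_step reaches_trans)
  qed
qed

section \<open>Half-edges as the states of the tour\<close>

definition half_edges :: "('v, 'e) ugraph \<Rightarrow> ('v \<times> 'e) set" where
  "half_edges G = {(v, g). v \<in> verts G \<and> g \<in> incident G v}"

lemma ribbon_structure_incident:
  assumes "ribbon_structure G \<sigma>" "v \<in> verts G" "g \<in> incident G v"
  shows "\<sigma> v g \<in> incident G v"
  using assms unfolding ribbon_structure_def by (metis cyclic_on_inI empty_iff)

lemma other_end_eq:
  assumes "ends G g = {v, w}"
  shows "other_end G g v = w"
  unfolding other_end_def using assms by (auto simp: doubleton_eq_iff)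

lemma half_edge_cases:
  assumes "connected_graph G" "(v, g) \<in> half_edges G"
  obtains w where "g \<in> edges G" "ends G g = {v, w}" "v \<noteq> w" "v \<in> verts G" "w \<in> verts G"
    "(w, g) \<in> half_edges G" "other_end G g v = w" "other_end G g w = v"
proof -
  have g: "g \<in> edges G" "v \<in> ends G g" "v \<in> verts G"
    using assms(2) by (auto simp: half_edges_def incident_def)
  obtain a b where ab: "ends G g = {a, b}" "a \<noteq> b" "a \<in> verts G" "b \<in> verts G"
    using connected_graph_ends[OF assms(1) g(1)] .
  define w where "w = (if v = a then b else a)"
  have "ends G g = {v, w}" "v \<noteq> w" "w \<in> verts G" using ab g by (auto simp: w_def)
  then show ?thesis using g
    by (intro that[of w]) (auto simp: half_edges_def incident_def other_end_eq insert_commute)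
qed

lemma bernardi_step_half_edges:
  assumes "connected_graph G" "ribbon_structure G \<sigma>" "s \<in> half_edges G"
  shows "bernardi_step G \<sigma> F s \<in> half_edges G"
    and "(fst s, fst (bernardi_step G \<sigma> F s)) \<in> linked G F"
proof -
  obtain v g where s: "s = (v, g)" by (cases s)
  obtain w where w: "g \<in> edges G" "ends G g = {v, w}" "v \<in> verts G" "w \<in> verts G"
      "(w, g) \<in> half_edges G" "other_end G g v = w"
    using half_edge_cases assms s by metis
  then show "bernardi_step G \<sigma> F s \<in> half_edges G"
    using ribbon_structure_incident[OF assms(2)] assms(3) s
    by (auto simp: bernardi_step_def half_edges_def Let_def)
  show "(fst s, fst (bernardi_step G \<sigma> F s)) \<in> linked G F"
    using w s by (auto simp: bernardi_step_def Let_def intro: linked_edge)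
qed

lemma bernardi_reaches_linked:
  assumes "connected_graph G" "ribbon_structure G \<sigma>"
    and "reaches (bernardi_step G \<sigma> F) s t" "s \<in> half_edges G"
  shows "t \<in> half_edges G \<and> (fst s, fst t) \<in> linked G F"
  using assms(3)
proof (induction rule: reaches_induct)
  case (step t)
  then show ?case using bernardi_step_half_edges[OF assms(1,2), of t F] linked_trans by metis
qed (use assms in simp)

text \<open>Adding a tree edge composes the step with the transposition of its two half-edges, which
  lie on different orbits before; this merges the two orbits.\<close>

lemma bernardi_reaches:
  assumes G: "connected_graph G" and R: "ribbon_structure G \<sigma>"
    and "finite F" "F \<subseteq> edges G" "\<And>C. is_cycle G C \<Longrightarrow> \<not> C \<subseteq> F"
    and "s \<in> half_edges G" "t \<in> half_edges G" "(fst s, fst t) \<in> linked G F"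
  shows "reaches (bernardi_step G \<sigma> F) s t"
  using assms(3-8)
proof (induction F arbitrary: s t rule: finite_induct)
  case empty
  then have "linked G {} = Id" by (auto simp: linked_def)
  then obtain v g h where st: "s = (v, g)" "t = (v, h)" using empty by (cases s; cases t) auto
  have vg: "v \<in> verts G" "g \<in> incident G v" "h \<in> incident G v"
    using empty st by (auto simp: half_edges_def)
  then have "cyclic_on (\<sigma> v) (incident G v)"
    using R unfolding ribbon_structure_def by blast
  then have "h \<in> orbit (\<sigma> v) g" using vg by (auto simp: cyclic_on_alldef)
  then obtain n where n: "h = (\<sigma> v ^^ n) g" by (auto simp: orbit_altdef)
  have "(bernardi_step G \<sigma> {} ^^ n) (v, g) = (v, (\<sigma> v ^^ n) g)"
    by (induction n) (auto simp: bernardi_step_def Let_def)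
  then show ?case using st n by (auto simp: reaches_def)
next
  case (insert h F)
  let ?\<pi> = "bernardi_step G \<sigma> F" and ?\<pi>' = "bernardi_step G \<sigma> (insert h F)"
  have IH: "reaches ?\<pi> s t" if "s \<in> half_edges G" "t \<in> half_edges G" "(fst s, fst t) \<in> linked G F" for s t
    using insert.IH[of s t] insert.prems that by blast
  have hE: "h \<in> edges G" using insert.prems by auto
  obtain p q where pq: "ends G h = {p, q}" "p \<noteq> q" "p \<in> verts G" "q \<in> verts G"
    using connected_graph_ends[OF G hE] .
  define a where "a = (p, h)"
  define b where "b = (q, h)"
  have ab: "a \<in> half_edges G" "b \<in> half_edges G" "fst a = p" "fst b = q"
    using pq hE by (auto simp: a_def b_def half_edges_def incident_def)
  have nl: "(p, q) \<notin> linked G F"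
  proof
    assume "(p, q) \<in> linked G F"
    moreover have "F \<subseteq> edges G" using insert.prems(1) by simp
    ultimately obtain C where C: "is_cycle G C" "C \<subseteq> insert h F"
      using linked_cycle[of F G h p q] insert.hyps(2) pq hE by metis
    then show False using insert.prems(2)[OF C(1)] by simp
  qed
  have eq: "?\<pi>' s = ?\<pi> s" if "s \<in> half_edges G" "s \<noteq> a" "s \<noteq> b" for s
  proof -
    have "snd s \<noteq> h"
      using that pq(1) by (cases s) (auto simp: a_def b_def half_edges_def incident_def)
    then show ?thesis by (simp add: bernardi_step_def)
  qed
  \<comment> \<open>Crossing \<open>h\<close> from \<open>p\<close> and then turning at
    \<open>q\<close> has the same result as skipping \<open>h\<close> at \<open>q\<close>, and
    conversely.\<close>
  have \<pi>'ab: "?\<pi>' a = ?\<pi> b" "?\<pi>' b = ?\<pi> a"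
    using pq insert.hyps other_end_eq[of G h p q] other_end_eq[of G h q p]
    by (auto simp: bernardi_step_def a_def b_def Let_def insert_commute)
  \<comment> \<open>The two steps may differ at pairs \<open>(v, h)\<close> that are no half-edges,
    whereas the orbit lemmas compare maps on the whole type. So \<open>\<rho>\<close> is the old
    step on half-edges, which the step does not leave, and the new step elsewhere.\<close>
  define \<rho> where "\<rho> s = (if s \<in> half_edges G then ?\<pi> s else ?\<pi>' s)" for s
  have \<rho>: "reaches \<rho> s t \<longleftrightarrow> reaches ?\<pi> s t" if s: "s \<in> half_edges G" for s t
  proof -
    have "(\<rho> ^^ n) s = (?\<pi> ^^ n) s \<and> (?\<pi> ^^ n) s \<in> half_edges G" for n
      by (induction n) (use s bernardi_step_half_edges[OF G R] in \<open>auto simp: \<rho>_def\<close>)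
    then show ?thesis by (auto simp: reaches_def)
  qed
  have eq\<rho>: "?\<pi>' s = \<rho> s" if "s \<noteq> a" "s \<noteq> b" for s
    using eq that by (auto simp: \<rho>_def)
  have lk: "(fst s, fst t) \<in> linked G F" if "reaches ?\<pi> s t" "s \<in> half_edges G" for s t
    using bernardi_reaches_linked[OF G R that] by simp
  have from_a: "reaches ?\<pi>' a t" if t: "t \<in> half_edges G" "(q, fst t) \<in> linked G F" for t
  proof (rule reaches_swap[of a b ?\<pi>' \<rho>])
    have b': "?\<pi> b \<in> half_edges G" "(q, fst (?\<pi> b)) \<in> linked G F"
      using bernardi_step_half_edges[OF G R ab(2)] ab by auto
    show "?\<pi>' a = \<rho> b" using \<pi>'ab ab by (simp add: \<rho>_def)
    show "\<not> reaches \<rho> (\<rho> b) a"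
      using \<rho>[OF b'(1)] ab lk[of "?\<pi> b" a] b' nl by (auto simp: \<rho>_def dest: linked_trans linked_sym)
    show "reaches \<rho> (\<rho> b) t"
      using \<rho>[OF b'(1)] ab IH[OF b'(1) t(1) linked_trans[OF linked_sym[OF b'(2)] t(2)]]
      by (simp add: \<rho>_def)
  qed (use eq\<rho> in auto)
  have from_b: "reaches ?\<pi>' b t" if t: "t \<in> half_edges G" "(p, fst t) \<in> linked G F" for t
  proof (rule reaches_swap[of b a ?\<pi>' \<rho>])
    have b': "?\<pi> a \<in> half_edges G" "(p, fst (?\<pi> a)) \<in> linked G F"
      using bernardi_step_half_edges[OF G R ab(1)] ab by auto
    show "?\<pi>' b = \<rho> a" using \<pi>'ab ab by (simp add: \<rho>_def)
    show "\<not> reaches \<rho> (\<rho> a) b"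
      using \<rho>[OF b'(1)] ab lk[of "?\<pi> a" b] b' nl by (auto simp: \<rho>_def dest: linked_trans linked_sym)
    show "reaches \<rho> (\<rho> a) t"
      using \<rho>[OF b'(1)] ab IH[OF b'(1) t(1) linked_trans[OF linked_sym[OF b'(2)] t(2)]]
      by (simp add: \<rho>_def)
  qed (use eq\<rho> in auto)
  have ab_ab: "reaches ?\<pi>' a b" "reaches ?\<pi>' b a"
    using from_a[of b] from_b[of a] ab by auto
  have until: "reaches ?\<pi>' s t \<or> reaches ?\<pi> s a \<and> reaches ?\<pi>' s a \<or> reaches ?\<pi> s b \<and> reaches ?\<pi>' s b"
    if "s \<in> half_edges G" "reaches ?\<pi> s t" for s t
    using reaches_until[of \<rho> s t a b ?\<pi>'] eq\<rho> \<rho>[OF that(1)] that(2) by metis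
  show ?case
  \<comment> \<open>If the component of \<open>s\<close> in \<open>F\<close> contains an end of
    \<open>h\<close>, the tour runs into \<open>h\<close>, hence through both of its half-edges, and
    from these covers the components of both ends. Otherwise it meets neither half-edge and is
    unchanged.\<close>
  proof (cases "(fst s, p) \<in> linked G F \<or> (fst s, q) \<in> linked G F")
    case True
    then have "reaches ?\<pi> s a \<or> reaches ?\<pi> s b"
      using IH[OF insert.prems(3) ab(1)] IH[OF insert.prems(3) ab(2)] ab by auto
    then have "reaches ?\<pi>' s a \<or> reaches ?\<pi>' s b"
      using until[OF insert.prems(3), of a] until[OF insert.prems(3), of b] by blast
    then have sab: "reaches ?\<pi>' s a" "reaches ?\<pi>' s b"
      using ab_ab reaches_trans by metis+
    have "(p, fst t) \<in> linked G F \<or> (q, fst t) \<in> linked G F"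
      using linked_insert[OF insert.prems(5) pq(1)] True linked_sym linked_trans by metis
    then show ?thesis
      using from_a[OF insert.prems(4)] from_b[OF insert.prems(4)] sab reaches_trans by metis
  next
    case False
    then have "(fst s, fst t) \<in> linked G F"
      using linked_insert[OF insert.prems(5) pq(1)] by auto
    then have "reaches ?\<pi> s t" using IH insert.prems by auto
    then show ?thesis using until[OF insert.prems(3)] lk insert.prems(3) False ab by metis
  qed
qed

lemma bernardi_reaches_tree:
  assumes "connected_graph G" "ribbon_structure G \<sigma>" "spanning_tree G T"
    and "s \<in> half_edges G" "t \<in> half_edges G"
  shows "reaches (bernardi_step G \<sigma> T) s t"
proof (rule bernardi_reaches[OF assms(1,2)])
  show "finite T"
    using assms finite_subset by (auto simp: connected_graph_def spanning_tree_def)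
  show "(fst s, fst t) \<in> linked G T"
    using assms by (auto simp: half_edges_def spanning_tree_def joined_by_linked)
qed (use assms in \<open>auto simp: spanning_tree_def\<close>)


section \<open>Winding numbers near a crosscut of a disc\<close>

lemma winding_number_part_circlepath_centre:
  assumes "s < t" "0 < r"
  shows "winding_number (part_circlepath v r s t) v = of_real ((t - s) / (2 * pi))"
proof -
  have "v \<notin> path_image (part_circlepath v r s t)"
    using in_path_image_part_circlepath[of v v r s t] assms by auto
  then have "winding_number (part_circlepath v r s t) v =
      1 / (2 * pi * \<i>) * contour_integral (part_circlepath v r s t) (\<lambda>w. 1 / (w - v))"
    by (simp add: winding_number_valid_path)
  also have "contour_integral (part_circlepath v r s t) (\<lambda>w. 1 / (w - v)) =
      integral {s..t} (\<lambda>u. 1 / (v + r * cis u - v) * r * \<i> * cis u)"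
    by (rule contour_integral_part_circlepath_eq[OF assms(1)])
  also have "(\<lambda>u. 1 / (v + r * cis u - v) * r * \<i> * cis u) = (\<lambda>u. \<i>)"
    using assms by (auto simp: cis_conv_exp)
  finally show ?thesis
    using assms by (simp add: scaleR_conv_of_real)
qed

lemma cis_eq_iff_small:
  assumes "cis a = cis b" "\<bar>a - b\<bar> < 2 * pi"
  shows "a = b"
proof -
  have "exp (\<i> * of_real a) = exp (\<i> * of_real b)"
    using assms(1) by (simp add: cis_conv_exp)
  then obtain n :: int where n: "\<i> * of_real a = \<i> * of_real b + of_int (2 * n) * of_real pi * \<i>"
    by (auto simp: exp_eq)
  then have "Im (\<i> * of_real a) = Im (\<i> * of_real b + of_int (2 * n) * of_real pi * \<i>)"
    by simp
  then have *: "a = b + 2 * of_int n * pi" by simp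
  then have "\<bar>of_int n\<bar> * (2 * pi) < 1 * (2 * pi)"
    using assms(2) by (simp add: abs_mult algebra_simps)
  then have "\<bar>of_int n :: real\<bar> < 1"
    using pi_gt_zero by (metis mult_less_cancel_right_pos mult_pos_pos zero_less_numeral)
  then have "n = 0" by linarith
  with * show ?thesis by simp
qed

text \<open>\<open>A\<close> and \<open>B\<close> are meant as the initial pieces of the entering
  and the leaving edge, and \<open>Z\<close> as the rest of the cycle from the end of
  \<open>B\<close> to the end of \<open>A\<close>; then B + Z - A is the winding number of the
  cycle. It splits into that of a closed curve in the disc, which is 0 on the left and 0 or -1 in
  general, and a remainder \<open>K\<close> that is constant near \<open>v\<close>.\<close>

lemma winding_number_left_of_crosscut:
  fixes v :: complex
  assumes r: "0 < r" and \<omega>: "\<omega> < 2 * pi" and \<phi>: "0 < \<phi>" "\<phi> < \<omega>"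
    and B: "arc B" "pathstart B = v" "pathfinish B = v + of_real r * cis \<theta>"
      "path_image B \<subseteq> insert (pathfinish B) (ball v r)"
    and A: "arc A" "pathstart A = v" "pathfinish A = v + of_real r * cis (\<theta> + \<omega>)"
      "path_image A \<subseteq> insert (pathfinish A) (ball v r)"
    and AB: "path_image A \<inter> path_image B = {v}"
    and Z: "path Z" "pathstart Z = pathfinish B" "pathfinish Z = pathfinish A" "v \<notin> path_image Z"
  obtains \<delta> K where "0 < \<delta>"
    "\<forall>z\<in>ball v \<delta> - (path_image A \<union> path_image B).
       winding_number B z + winding_number Z z - winding_number A z \<in> {K, K - 1}"
    "\<forall>Q. connected Q \<and> Q \<subseteq> insert (v + of_real r * cis (\<theta> + \<phi>)) (ball v r) \<and>
       v + of_real r * cis (\<theta> + \<phi>) \<in> Q \<and> Q \<inter> (path_image A \<union> path_image B) = {} \<longrightarrow>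
       (\<forall>z\<in>Q \<inter> ball v \<delta>. winding_number B z + winding_number Z z - winding_number A z = K)"
proof -
  \<comment> \<open>Both arcs run counter-clockwise: \<beta> on the left, from the end of
    \<open>B\<close> to the end of \<open>A\<close>, and \<alpha> on the right, back to the end of
    \<open>B\<close>. Together they form the full circle.\<close>
  define \<alpha> where "\<alpha> = part_circlepath v r (\<theta> + \<omega>) (\<theta> + 2 * pi)"
  define \<beta> where "\<beta> = part_circlepath v r \<theta> (\<theta> + \<omega>)"
  define X where "X = reversepath A +++ B"
  \<comment> \<open>\<open>J\<close> and \<open>J'\<close> close the same crosscut, \<open>J\<close>
    clockwise along the right arc and \<open>J'\<close> counter-clockwise along the left one.
    \<open>L\<close> closes \<open>Z\<close> by \<alpha>, so that the contributions of \<alpha> to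
    \<open>J\<close> and \<open>L\<close> cancel.\<close>
  define J where "J = X +++ reversepath \<alpha>"
  define J' where "J' = X +++ \<beta>"
  define L where "L = Z +++ \<alpha>"
  have \<omega>0: "0 < \<omega>" using \<phi> by simp
  have pA: "path A" and pB: "path B" using A B by (simp_all add: arc_imp_path)
  have cis_add_2pi: "cis (t + 2 * pi) = cis t" for t :: real
    by (simp flip: cis_mult)
  have \<alpha>: "path \<alpha>" "pathstart \<alpha> = pathfinish A" "pathfinish \<alpha> = pathfinish B"
    "path_image \<alpha> \<subseteq> sphere v r" "arc \<alpha>"
    using \<omega> \<omega>0 r A B cis_add_2pi[of \<theta>] unfolding \<alpha>_def
    by (auto intro!: path_image_part_circlepath_subset' arc_part_circlepath simp: cis_conv_exp)
  have \<beta>: "path \<beta>" "pathstart \<beta> = pathfinish B" "pathfinish \<beta> = pathfinish A"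
    "path_image \<beta> \<subseteq> sphere v r" "arc \<beta>"
    using \<omega> \<omega>0 r A B unfolding \<beta>_def
    by (auto intro!: path_image_part_circlepath_subset' arc_part_circlepath simp: cis_conv_exp)
  have imX: "path_image X = path_image A \<union> path_image B"
    unfolding X_def using A B by (simp add: path_image_join)
  have aX: "arc X" unfolding X_def
    using A B AB by (intro arc_join) (auto simp: arc_reversepath)
  have X: "path X" "pathstart X = pathfinish A" "pathfinish X = pathfinish B"
    using aX A B by (auto simp: arc_imp_path X_def)
  have Xs: "path_image X \<inter> sphere v r \<subseteq> {pathfinish A, pathfinish B}"
    using A(4) B(4) unfolding imX by auto
  have X\<alpha>: "path_image X \<inter> path_image \<alpha> \<subseteq> {pathfinish A, pathfinish B}"
    and X\<beta>: "path_image X \<inter> path_image \<beta> \<subseteq> {pathfinish A, pathfinish B}"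
    using Xs \<alpha>(4) \<beta>(4) by blast+
  have sJ: "simple_path J" "pathfinish J = pathstart J"
    unfolding J_def using X aX \<alpha> X\<alpha>
    by (auto intro!: simple_path_join_loop simp: arc_reversepath)
  have sJ': "simple_path J'" "pathfinish J' = pathstart J'"
    unfolding J'_def using X aX \<beta> X\<beta>
    by (auto intro!: simple_path_join_loop)
  have imJ: "path_image J = path_image A \<union> path_image B \<union> path_image \<alpha>"
    unfolding J_def using X \<alpha> imX by (simp add: path_image_join)
  have imJ': "path_image J' = path_image A \<union> path_image B \<union> path_image \<beta>"
    unfolding J'_def using X \<beta> imX by (simp add: path_image_join)
  have imL: "path_image L = path_image Z \<union> path_image \<alpha>"
    unfolding L_def using Z \<alpha> by (simp add: path_image_join)
  have pL: "path L" "pathfinish L = pathstart L"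
    unfolding L_def using Z \<alpha> by auto
  have wX: "winding_number X z = winding_number B z - winding_number A z"
    if "z \<notin> path_image A \<union> path_image B" for z
    unfolding X_def using that A B pA pB
    by (simp add: winding_number_join winding_number_reversepath)
  have wJ: "winding_number J z = winding_number B z - winding_number A z - winding_number \<alpha> z"
    if "z \<notin> path_image A \<union> path_image B" "z \<notin> path_image \<alpha>" for z
    unfolding J_def using that X \<alpha> imX wX[of z]
    by (simp add: winding_number_join winding_number_reversepath)
  have wJ': "winding_number J' z = winding_number B z - winding_number A z + winding_number \<beta> z"
    if "z \<notin> path_image A \<union> path_image B" "z \<notin> path_image \<beta>" for z
    unfolding J'_def using that X \<beta> imX wX[of z]
    by (simp add: winding_number_join)
  have ball_\<alpha>\<beta>: "z \<notin> path_image \<alpha>" "z \<notin> path_image \<beta>" if "z \<in> ball v r" for z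
    using that \<alpha>(4) \<beta>(4) by (auto simp: sphere_def)
  have circ: "winding_number \<alpha> z + winding_number \<beta> z = 1" if z: "z \<in> ball v r" for z
  proof -
    have "winding_number (\<alpha> +++ \<beta>) z = winding_number (\<alpha> +++ \<beta>) v"
    proof (rule winding_number_eq[where S = "ball v r"])
      show "ball v r \<inter> path_image (\<alpha> +++ \<beta>) = {}"
        using ball_\<alpha>\<beta> \<alpha> \<beta> by (auto simp: path_image_join)
    qed (use \<alpha> \<beta> r z in auto)
    moreover have "winding_number (\<alpha> +++ \<beta>) z = winding_number \<alpha> z + winding_number \<beta> z"
      if "z \<in> ball v r" for z
      using \<alpha> \<beta> ball_\<alpha>\<beta>[OF that] by (simp add: winding_number_join)
    moreover have "winding_number \<alpha> v + winding_number \<beta> v = 1"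
    proof -
      have "winding_number \<alpha> v = of_real ((\<theta> + 2 * pi - (\<theta> + \<omega>)) / (2 * pi))"
        unfolding \<alpha>_def using \<omega> r by (intro winding_number_part_circlepath_centre) auto
      moreover have "winding_number \<beta> v = of_real ((\<theta> + \<omega> - \<theta>) / (2 * pi))"
        unfolding \<beta>_def using \<omega>0 r by (intro winding_number_part_circlepath_centre) auto
      ultimately have "winding_number \<alpha> v + winding_number \<beta> v =
          of_real ((\<theta> + 2 * pi - (\<theta> + \<omega>)) / (2 * pi) + (\<theta> + \<omega> - \<theta>) / (2 * pi))"
        by (simp only: of_real_add)
      also have "(\<theta> + 2 * pi - (\<theta> + \<omega>)) / (2 * pi) + (\<theta> + \<omega> - \<theta>) / (2 * pi) = 1"
        by (simp add: field_simps)
      finally show ?thesis by simp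
    qed
    ultimately show ?thesis using z r by simp
  qed
  \<comment> \<open>Inside the disc the winding numbers of \<open>J'\<close> and \<open>J\<close>
    differ by the 1 of the full circle. Both curves are simple, so both numbers lie in {-1, 0, 1},
    which excludes 1 for \<open>J\<close>.\<close>
  have J01: "winding_number J z \<in> {0, - 1}"
    if z: "z \<in> ball v r" "z \<notin> path_image A \<union> path_image B" for z
  proof -
    have "winding_number J z \<in> {-1, 0, 1}"
      using z ball_\<alpha>\<beta>[OF z(1)] sJ by (intro simple_closed_path_winding_number_cases) (auto simp: imJ)
    moreover have "winding_number J' z \<in> {-1, 0, 1}"
      using z ball_\<alpha>\<beta>[OF z(1)] sJ' by (intro simple_closed_path_winding_number_cases) (auto simp: imJ')
    moreover have "winding_number \<beta> z = 1 - winding_number \<alpha> z"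
      using circ[OF z(1)] by (simp add: eq_diff_eq add.commute)
    then have "winding_number J' z = winding_number J z + 1"
      using wJ[of z] wJ'[of z] z ball_\<alpha>\<beta>[OF z(1)] by simp
    ultimately show ?thesis by auto
  qed
  have vL: "v \<notin> path_image L"
    using Z(4) ball_\<alpha>\<beta>(1)[of v] r by (auto simp: imL)
  then obtain d where d: "0 < d" "ball v d \<inter> path_image L = {}"
    using closed_path_image[OF pL(1)] unfolding closed_def open_contains_ball by blast
  \<comment> \<open>\<open>Z\<close> may re-enter the disc of radius \<open>r\<close>; only a
    smaller disc is known to avoid it.\<close>
  define \<delta> where "\<delta> = min d r"
  have \<delta>: "0 < \<delta>" "\<delta> \<le> r" "ball v \<delta> \<inter> path_image L = {}"
    using d r by (auto simp: \<delta>_def)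
  define K where "K = winding_number L v"
  have K: "winding_number Z z + winding_number \<alpha> z = K" if "z \<in> ball v \<delta>" for z
  proof -
    have "winding_number L z = K"
      unfolding K_def using that \<delta> pL by (intro winding_number_eq[where S = "ball v \<delta>"]) auto
    moreover have "winding_number L z = winding_number Z z + winding_number \<alpha> z"
      unfolding L_def using that \<delta>(3) Z \<alpha> by (intro winding_number_join) (auto simp: imL)
    ultimately show ?thesis by simp
  qed
  have main: "winding_number B z + winding_number Z z - winding_number A z = winding_number J z + K"
    if "z \<in> ball v \<delta>" "z \<notin> path_image A \<union> path_image B" for z
    using wJ[OF that(2)] ball_\<alpha>\<beta>(1)[of z] that \<delta> K[OF that(1)] by (auto simp: algebra_simps)
  have near: "winding_number B z + winding_number Z z - winding_number A z \<in> {K, K - 1}"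
    if z: "z \<in> ball v \<delta>" "z \<notin> path_image A \<union> path_image B" for z
    using main[OF z] J01[of z] z \<delta> by (auto simp: algebra_simps)
  have left: "winding_number B z + winding_number Z z - winding_number A z = K"
    if Q: "connected Q" "Q \<subseteq> insert (v + of_real r * cis (\<theta> + \<phi>)) (ball v r)"
       "v + of_real r * cis (\<theta> + \<phi>) \<in> Q" "Q \<inter> (path_image A \<union> path_image B) = {}"
       "z \<in> Q" "z \<in> ball v \<delta>" for Q z
  proof -
    define q where "q = v + of_real r * cis (\<theta> + \<phi>)"
    \<comment> \<open>From \<open>q\<close>, which lies on the left arc, one can leave the disc
      radially without meeting \<open>J\<close>. The factor 2 merely puts \<open>q'\<close> outside
      the closed disc that contains \<open>J\<close>, where its winding number vanishes.\<close>
    define q' where "q' = v + of_real (2 * r) * cis (\<theta> + \<phi>)"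
    have nv: "dist v q = r" using r by (simp add: q_def dist_norm norm_mult)
    have q\<alpha>: "q \<notin> path_image \<alpha>"
    proof
      assume "q \<in> path_image \<alpha>"
      then obtain u where u: "\<theta> + \<omega> \<le> u" "u \<le> \<theta> + 2 * pi" "q = v + of_real r * exp (\<i> * of_real u)"
        using \<omega> by (auto simp: \<alpha>_def path_image_part_circlepath)
      then have "cis (\<theta> + \<phi>) = cis u" using r by (auto simp: q_def cis_conv_exp)
      then have "\<theta> + \<phi> = u" using u \<phi> \<omega> by (intro cis_eq_iff_small) (auto simp: abs_if)
      with u \<phi> show False by simp
    qed
    have qJ: "q \<notin> path_image J"
      using q\<alpha> Q by (auto simp: imJ q_def)
    have seg: "w = q \<or> r < dist v w" if w: "w \<in> closed_segment q q'" for w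
    proof -
      obtain u where u: "0 \<le> u" "u \<le> 1" "w = (1 - u) *\<^sub>R q + u *\<^sub>R q'"
        using w by (auto simp: closed_segment_def)
      then have "w = v + of_real ((1 + u) * r) * cis (\<theta> + \<phi>)"
        by (simp add: q_def q'_def scaleR_conv_of_real algebra_simps)
      moreover from this have "dist v w = (1 + u) * r"
        using r u by (simp add: dist_norm norm_mult del: of_real_mult of_real_add)
      ultimately show ?thesis using u r by (cases "u = 0") (auto simp: q_def)
    qed
    have Jc: "path_image J \<subseteq> cball v r"
      using A(3,4) B(3,4) \<alpha>(4) r unfolding imJ by (force simp: sphere_def dist_norm norm_mult)
    have "winding_number J z = winding_number J q"
    proof (rule winding_number_eq[where S = Q])
      show "Q \<inter> path_image J = {}"
        using Q(2,4) q\<alpha> ball_\<alpha>\<beta>(1) unfolding imJ q_def by blast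
    qed (use Q sJ in \<open>auto simp: q_def simple_path_imp_path\<close>)
    also have "\<dots> = winding_number J q'"
    proof (rule winding_number_eq[where S = "closed_segment q q'"])
      show "closed_segment q q' \<inter> path_image J = {}"
        using seg Jc qJ by force
    qed (use sJ in \<open>auto simp: simple_path_imp_path\<close>)
    also have "\<dots> = 0"
      using Jc sJ r by (intro winding_number_zero_outside[of J "cball v r"])
        (auto simp: simple_path_imp_path q'_def dist_norm norm_mult)
    finally show ?thesis
      using main[of z] Q by auto
  qed
  show ?thesis
    by (rule that[OF \<delta>(1), of K]; intro ballI allI impI; elim conjE DiffE IntE;
        rule near left; assumption)
qed


section \<open>Counter-clockwise angles\<close>

text \<open>For points at the same distance from \<open>v\<close> the quotient in
  \<open>ccw_angle\<close> has modulus 1. This turns angles between exit points into the parameters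
  \<phi> and \<omega> of the crosscut lemma.\<close>

lemma ccw_angle_cis:
  assumes "0 < r" "dist v q = r" "p = v + of_real r * cis \<theta>"
  shows "q = v + of_real r * cis (\<theta> + ccw_angle v p q)"
proof -
  have "p - v = of_real r * cis \<theta>" "p \<noteq> v" using assms by auto
  have "norm (q - v) = r" using assms(2) by (simp add: dist_norm norm_minus_commute)
  then have "norm ((q - v) / (p - v)) = 1"
    using assms \<open>p - v = _\<close> by (simp add: norm_divide norm_mult)
  then have "(q - v) / (p - v) = cis (ccw_angle v p q)"
    using Arg2pi_eq[of "(q - v) / (p - v)"] by (simp add: ccw_angle_def cis_conv_exp)
  then have "q - v = cis (ccw_angle v p q) * (p - v)"
    using \<open>p \<noteq> v\<close> by (simp add: field_simps)
  also have "\<dots> = of_real r * cis (\<theta> + ccw_angle v p q)"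
    unfolding \<open>p - v = _\<close> by (simp add: cis_mult [symmetric] mult.left_commute mult.commute)
  finally show ?thesis by (simp add: algebra_simps)
qed

lemma ccw_angle_bounds: "0 \<le> ccw_angle v p q" "ccw_angle v p q < 2 * pi"
  by (simp_all add: ccw_angle_def Arg2pi_ge_0 Arg2pi_lt_2pi)

lemma polar_form_on_circle:
  assumes "0 < r" "dist v p = r"
  obtains \<theta> where "p = v + of_real r * cis \<theta>"
  using Arg2pi_eq[of "p - v"] assms
  by (metis add_diff_cancel_left' cis_conv_exp diff_add_cancel dist_commute dist_norm add.commute)

lemma ccw_angle_eq_imp_eq:
  assumes "0 < r" "dist v p = r" "dist v q = r" "dist v s = r" "ccw_angle v p q = ccw_angle v p s"
  shows "q = s"
proof -
  obtain \<theta> where \<theta>: "p = v + of_real r * cis \<theta>" using polar_form_on_circle assms by blast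
  show ?thesis
    using ccw_angle_cis[OF assms(1,3) \<theta>] ccw_angle_cis[OF assms(1,4) \<theta>] assms(5) by metis
qed

lemma ccw_angle_pos:
  assumes "0 < r" "dist v p = r" "dist v q = r" "p \<noteq> q"
  shows "0 < ccw_angle v p q"
proof -
  have "p \<noteq> v" using assms by auto
  then have "ccw_angle v p p = 0" using Arg2pi_of_real[of 1] by (simp add: ccw_angle_def)
  then have "ccw_angle v p q \<noteq> 0"
    using ccw_angle_eq_imp_eq[OF assms(1,2,2,3)] assms(4) by auto
  then show ?thesis using ccw_angle_bounds(1)[of v p q] by simp
qed

lemma ccw_angle_diff:
  assumes "p \<noteq> v" "q \<noteq> v" "s \<noteq> v" "ccw_angle v p q \<le> ccw_angle v p s"
  shows "ccw_angle v q s = ccw_angle v p s - ccw_angle v p q"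
proof -
  have "(s - v) / (p - v) / ((q - v) / (p - v)) = (s - v) / (q - v)"
    using assms by simp
  then show ?thesis
    using Arg2pi_divide[of "(q - v) / (p - v)" "(s - v) / (p - v)"] assms
    by (simp add: ccw_angle_def)
qed

lemma ccw_angle_add:
  assumes "p \<noteq> v" "q \<noteq> v" "s \<noteq> v" "ccw_angle v p q + ccw_angle v q s < 2 * pi"
  shows "ccw_angle v p s = ccw_angle v p q + ccw_angle v q s"
proof -
  have "(q - v) / (p - v) * ((s - v) / (q - v)) = (s - v) / (p - v)"
    using assms by simp
  then show ?thesis
    using Arg2pi_times[of "(q - v) / (p - v)" "(s - v) / (q - v)"] assms
    by (simp add: ccw_angle_def)
qed

lemma ccw_angle_swap:
  assumes "p \<noteq> v" "q \<noteq> v" "0 < ccw_angle v p q"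
  shows "ccw_angle v q p = 2 * pi - ccw_angle v p q"
proof -
  have [simp]: "(q - v) / (p - v) * ((p - v) / (q - v)) = 1" using assms by simp
  have "Arg2pi ((q - v) / (p - v)) + Arg2pi ((p - v) / (q - v)) = 0 \<or>
      Arg2pi ((q - v) / (p - v)) + Arg2pi ((p - v) / (q - v)) = 2 * pi"
    using Arg2pi_add[of "(q - v) / (p - v)" "(p - v) / (q - v)"] assms(1,2) Arg2pi_of_real[of 1]
    by (simp del: times_divide_eq_right times_divide_eq_left times_divide_times_eq split: if_splits)
  then show ?thesis
    using assms(3) ccw_angle_bounds(1)[of v q p] by (auto simp: ccw_angle_def)
qed


section \<open>Cycles of plane graphs\<close>

locale plane =
  fixes G :: "(complex, 'e) ugraph" and \<gamma> :: "'e \<Rightarrow> real \<Rightarrow> complex"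
  assumes plane: "plane_graph G \<gamma>"
begin

lemma connected: "connected_graph G"
  using plane by (simp add: plane_graph_def)

lemma arc_edge: "g \<in> edges G \<Longrightarrow> arc (\<gamma> g)"
  using plane by (simp add: plane_graph_def)

lemma vertex_on_edge: "g \<in> edges G \<Longrightarrow> v \<in> verts G \<Longrightarrow> v \<in> path_image (\<gamma> g) \<Longrightarrow> v \<in> ends G g"
  using plane by (auto simp: plane_graph_def)

lemma edges_meet:
  assumes "g \<in> edges G" "h \<in> edges G" "g \<noteq> h" "z \<in> path_image (\<gamma> g)" "z \<in> path_image (\<gamma> h)"
  shows "z \<in> verts G" "z \<in> ends G g" "z \<in> ends G h"
proof -
  show "z \<in> verts G" using plane assms unfolding plane_graph_def by blast
  then show "z \<in> ends G g" "z \<in> ends G h" using assms vertex_on_edge by auto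
qed

lemma curve_from:
  assumes "g \<in> edges G" "ends G g = {u, w}"
  shows "arc (curve_from \<gamma> u g)" "pathstart (curve_from \<gamma> u g) = u"
    "pathfinish (curve_from \<gamma> u g) = w" "path_image (curve_from \<gamma> u g) = path_image (\<gamma> g)"
    "curve_from \<gamma> w g = reversepath (curve_from \<gamma> u g)" "u \<noteq> w" "u \<in> verts G" "w \<in> verts G"
    "path (curve_from \<gamma> u g)"
proof -
  have a: "arc (\<gamma> g)" and e: "{u, w} = {pathstart (\<gamma> g), pathfinish (\<gamma> g)}"
    using assms plane by (auto simp: plane_graph_def)
  have ne: "pathstart (\<gamma> g) \<noteq> pathfinish (\<gamma> g)" using arc_distinct_ends[OF a] by simp
  then have "u = pathstart (\<gamma> g) \<and> w = pathfinish (\<gamma> g) \<or> w = pathstart (\<gamma> g) \<and> u = pathfinish (\<gamma> g)"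
    using e by (auto simp: doubleton_eq_iff)
  then show "arc (curve_from \<gamma> u g)" "pathstart (curve_from \<gamma> u g) = u"
    "pathfinish (curve_from \<gamma> u g) = w" "path_image (curve_from \<gamma> u g) = path_image (\<gamma> g)"
    "curve_from \<gamma> w g = reversepath (curve_from \<gamma> u g)" "u \<noteq> w"
    using a ne by (auto simp: curve_from_def arc_reversepath)
  then show "path (curve_from \<gamma> u g)" by (simp add: arc_imp_path)
  show "u \<in> verts G" "w \<in> verts G"
    using assms connected unfolding connected_graph_def by auto
qed

lemma curve_from_open_image:
  assumes "g \<in> edges G" "ends G g = {u, w}"
  shows "curve_from \<gamma> u g ` {0<..<1} = \<gamma> g ` {0<..<1}"
proof -
  have "(\<lambda>t. 1 - t) ` {0<..<1} = {0<..<1::real}"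
    by (auto simp: image_def intro!: bexI[of _ "1 - _"])
  then have "reversepath (\<gamma> g) ` {0<..<1} = \<gamma> g ` {0<..<1}"
    unfolding reversepath_def image_image[of "\<gamma> g" "\<lambda>t. 1 - t", symmetric] by simp
  then show ?thesis by (simp add: curve_from_def)
qed

lemma curve_from_inj:
  assumes "g \<in> edges G" "ends G g = {u, w}" "0 \<le> s" "s \<le> 1" "0 \<le> t" "t \<le> 1"
    and "curve_from \<gamma> u g s = curve_from \<gamma> u g t"
  shows "s = t"
  using curve_from(1)[OF assms(1,2)] assms(3-) by (auto simp: arc_def dest: inj_onD)

lemma open_edge_not_vertex:
  assumes "g \<in> edges G" "z \<in> \<gamma> g ` {0<..<1}"
  shows "z \<notin> verts G"
proof
  assume z: "z \<in> verts G"
  obtain t where t: "0 < t" "t < 1" "z = \<gamma> g t" using assms(2) by auto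
  have "z \<in> ends G g" using z t assms by (intro vertex_on_edge) (auto simp: path_image_def)
  moreover have "ends G g = {\<gamma> g 0, \<gamma> g 1}"
    using plane assms(1) by (auto simp: plane_graph_def pathstart_def pathfinish_def)
  moreover have "inj_on (\<gamma> g) {0..1}" using arc_edge[OF assms(1)] by (simp add: arc_def)
  ultimately show False using t by (auto dest: inj_onD)
qed

lemma open_edge_avoids:
  assumes "g \<in> edges G" "C \<subseteq> edges G" "g \<notin> C"
  shows "\<gamma> g ` {0<..<1} \<inter> cycle_image \<gamma> C = {}"
proof (rule ccontr)
  assume "\<not> ?thesis"
  then obtain z c where z: "z \<in> \<gamma> g ` {0<..<1}" "c \<in> C" "z \<in> path_image (\<gamma> c)"
    by (auto simp: cycle_image_def)
  moreover from z have "z \<in> path_image (\<gamma> g)" by (auto simp: path_image_def)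
  ultimately have "z \<in> verts G" using assms edges_meet(1)[of g c z] by auto
  then show False using open_edge_not_vertex assms z by auto
qed

lemma in_cycle_image_darts:
  assumes "z \<in> cycle_image \<gamma> (dart_edge ` set ds)"
  obtains a g b where "(a, g, b) \<in> set ds" "z \<in> path_image (\<gamma> g)"
proof -
  obtain d where d: "d \<in> set ds" "z \<in> path_image (\<gamma> (dart_edge d))"
    using assms by (auto simp: cycle_image_def)
  show ?thesis by (rule that[of "fst d" "dart_edge d" "snd (snd d)"]) (use d in \<open>simp_all add: dart_edge_def\<close>)
qed

section \<open>Walks as paths, cycles as Jordan curves with two sides\<close>

lemma walk_path:
  "dart_walk G u ds w \<Longrightarrow> ds \<noteq> [] \<Longrightarrow>
     path (walk_path \<gamma> ds) \<and> pathstart (walk_path \<gamma> ds) = u \<and> pathfinish (walk_path \<gamma> ds) = w \<and>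
     path_image (walk_path \<gamma> ds) = cycle_image \<gamma> (dart_edge ` set ds)"
proof (induction ds arbitrary: u)
  case (Cons d ds)
  obtain g b where d: "d = (u, g, b)" "g \<in> edges G" "ends G g = {u, b}" "dart_walk G b ds w"
    using Cons.prems by (cases d) auto
  note c = curve_from[OF d(2,3)]
  show ?case
  proof (cases ds)
    case Nil
    then show ?thesis using c d by (simp add: dart_simps cycle_image_def)
  next
    case (Cons d' ds')
    then show ?thesis using c d Cons.IH[OF d(4)]
      by (simp add: path_image_join dart_simps cycle_image_def)
  qed
qed simp

lemma winding_number_walk_path:
  "dart_walk G u ds w \<Longrightarrow> ds \<noteq> [] \<Longrightarrow> z \<notin> cycle_image \<gamma> (dart_edge ` set ds) \<Longrightarrow>
     winding_number (walk_path \<gamma> ds) z =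
       (\<Sum>d\<leftarrow>ds. winding_number (curve_from \<gamma> (dart_tail d) (dart_edge d)) z)"
proof (induction ds arbitrary: u)
  case (Cons d ds)
  obtain g b where d: "d = (u, g, b)" "g \<in> edges G" "ends G g = {u, b}" "dart_walk G b ds w"
    using Cons.prems by (cases d) auto
  note c = curve_from[OF d(2,3)]
  show ?case
  proof (cases ds)
    case (Cons d' ds')
    then show ?thesis using c d Cons.IH[OF d(4)] Cons.prems walk_path[OF d(4)]
      by (simp add: winding_number_join dart_simps cycle_image_def)
  qed simp
qed simp

lemma arc_walk_path:
  "dart_walk G u ds w \<Longrightarrow> ds \<noteq> [] \<Longrightarrow> distinct (map dart_tail ds @ [w]) \<Longrightarrow> arc (walk_path \<gamma> ds)"
proof (induction ds arbitrary: u)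
  case (Cons d ds)
  obtain g b where d: "d = (u, g, b)" "g \<in> edges G" "ends G g = {u, b}" "dart_walk G b ds w"
    using Cons.prems by (cases d) auto
  note c = curve_from[OF d(2,3)]
  show ?case
  proof (cases ds)
    case Nil
    then show ?thesis using c d by (simp add: dart_simps)
  next
    case (Cons d' ds')
    note wp = walk_path[OF d(4)]
    have dist: "distinct (map dart_edge (d # ds))"
      using dart_walk_distinct_edges Cons.prems by metis
    have "z = b" if z: "z \<in> path_image (\<gamma> g)" "z \<in> path_image (walk_path \<gamma> ds)" for z
    proof -
      obtain a' g' b' where d': "(a', g', b') \<in> set ds" "z \<in> path_image (\<gamma> g')"
        using z(2) wp Cons in_cycle_image_darts[of z ds] by auto
      have g': "g' \<in> edges G" "ends G g' = {a', b'}" using dart_walk_valid[OF d(4) d'(1)] by auto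
      have "g \<noteq> g'" using dist d d' by (force simp: dart_simps)
      then have "z \<in> {u, b}" "z \<in> {a', b'}" using edges_meet[of g g' z] d g' d' z by auto
      moreover have "a' \<in> set (map dart_tail ds @ [w])" "b' \<in> set (map dart_tail ds @ [w])"
        using imageI[OF d'(1), of dart_tail] imageI[OF d'(1), of dart_head]
          arg_cong[OF dart_walk_verts[OF d(4)], of set] by (auto simp: dart_simps)
      moreover have "u \<notin> set (map dart_tail ds @ [w])" using Cons.prems d by (auto simp: dart_simps)
      ultimately show ?thesis by auto
    qed
    then have "path_image (\<gamma> g) \<inter> path_image (walk_path \<gamma> ds) \<subseteq> {b}" by blast
    moreover have "arc (walk_path \<gamma> ds)"
      using Cons.IH[OF d(4)] Cons Cons.prems by auto
    ultimately show ?thesis using c d wp Cons by (auto simp: dart_simps intro!: arc_join)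
  qed
qed simp

lemma cycle_walk_edges:
  assumes "cycle_walk G ds"
  shows "dart_edge ` set ds \<subseteq> edges G"
  using assms by (auto simp: cycle_walk_def)

lemma cycle_walk_dart:
  assumes "cycle_walk G ds" "(a, g, b) \<in> set ds"
  shows "g \<in> edges G" "ends G g = {a, b}" "a \<noteq> b" "a \<in> verts G" "b \<in> verts G"
proof -
  show "g \<in> edges G" "ends G g = {a, b}"
    using assms by (auto simp: cycle_walk_def dart_simps dest!: bspec[of _ _ "(a, g, b)"])
  from curve_from[OF this] show "a \<noteq> b" "a \<in> verts G" "b \<in> verts G" by auto
qed

text \<open>Agreement of tails or edges is covered by the distinctness in \<open>cycle_walk\<close>.
  Heads are the tails of the reversed walk.\<close>

lemma cycle_walk_unique:
  assumes "cycle_walk G ds" "(a, g, b) \<in> set ds" "(a', g', b') \<in> set ds"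
  shows "a = a' \<or> g = g' \<or> b = b' \<Longrightarrow> (a, g, b) = (a', g', b')"
proof -
  have tails: "(a, g, b) = (a', g', b')"
    if "cycle_walk G ds" "(a, g, b) \<in> set ds" "(a', g', b') \<in> set ds" "a = a' \<or> g = g'"
    for ds :: "(complex, 'e) dart list" and a g b a' g' b'
  proof -
    have "inj_on dart_tail (set ds)" "inj_on dart_edge (set ds)"
      using that by (auto simp: cycle_walk_def distinct_map)
    from this(1)[THEN inj_onD, OF _ that(2,3)] this(2)[THEN inj_onD, OF _ that(2,3)] that(4)
    show ?thesis by (auto simp: dart_simps)
  qed
  have "(b, g, a) \<in> set (reverse_walk ds)" "(b', g', a') \<in> set (reverse_walk ds)"
    using assms(2,3) by (simp_all add: dart_in_reverse_walk)
  from tails[OF cycle_walk_reverse[OF assms(1)] this]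
  have "(b, g, a) = (b', g', a')" if "b = b'" using that by blast
  moreover have "(a, g, b) = (a', g', b')" if "a = a' \<or> g = g'"
    by (rule tails[OF assms that])
  moreover assume "a = a' \<or> g = g' \<or> b = b'"
  ultimately show "(a, g, b) = (a', g', b')" by blast
qed

text \<open>Writing the winding number as a sum over the set of darts frees it from the starting
  vertex, so that a cycle can be cut open at any vertex without changing it.\<close>

lemma cycle_walk_path:
  assumes "cycle_walk G ds"
  shows "simple_path (walk_path \<gamma> ds)" "pathfinish (walk_path \<gamma> ds) = pathstart (walk_path \<gamma> ds)"
    "path_image (walk_path \<gamma> ds) = cycle_image \<gamma> (dart_edge ` set ds)"
    "\<And>z. z \<notin> cycle_image \<gamma> (dart_edge ` set ds) \<Longrightarrow> winding_number (walk_path \<gamma> ds) z =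
       (\<Sum>d\<in>set ds. winding_number (curve_from \<gamma> (dart_tail d) (dart_edge d)) z)"
proof -
  obtain u where u: "dart_walk G u ds u" and dist: "distinct (map dart_tail ds)"
    "distinct (map dart_edge ds)" and len: "2 \<le> length ds"
    using assms by (auto simp: cycle_walk_iff)
  have ne: "ds \<noteq> []" using len by auto
  note wp = walk_path[OF u ne]
  show "pathfinish (walk_path \<gamma> ds) = pathstart (walk_path \<gamma> ds)"
    "path_image (walk_path \<gamma> ds) = cycle_image \<gamma> (dart_edge ` set ds)" using wp by auto
  have "distinct ds" using dist by (simp add: distinct_map)
  then show "winding_number (walk_path \<gamma> ds) z =
       (\<Sum>d\<in>set ds. winding_number (curve_from \<gamma> (dart_tail d) (dart_edge d)) z)"
    if "z \<notin> cycle_image \<gamma> (dart_edge ` set ds)" for z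
    using winding_number_walk_path[OF u ne that] by (simp add: sum_list_distinct_conv_sum_set)
  obtain g b ds' where d: "ds = (u, g, b) # ds'" "g \<in> edges G" "ends G g = {u, b}" "dart_walk G b ds' u"
    using u ne by (cases ds) auto
  note c = curve_from[OF d(2,3)]
  have ne': "ds' \<noteq> []" using d(1) len by auto
  note wp' = walk_path[OF d(4) ne']
  have dist': "distinct (map dart_tail ds' @ [u])" using dist d by (auto simp: dart_simps)
  have "z = b \<or> z = u" if z: "z \<in> path_image (\<gamma> g)" "z \<in> path_image (walk_path \<gamma> ds')" for z
  proof -
    obtain a' g' b' where d': "(a', g', b') \<in> set ds'" "z \<in> path_image (\<gamma> g')"
      using z(2) wp' in_cycle_image_darts[of z ds'] by auto
    have g': "g' \<in> edges G" using dart_walk_valid[OF d(4) d'(1)] by auto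
    have "g \<noteq> g'" using dist d d' by (force simp: dart_simps)
    then show ?thesis using edges_meet[of g g' z] d g' d' z by auto
  qed
  then have "simple_path (curve_from \<gamma> u g +++ walk_path \<gamma> ds')"
    using c wp' arc_walk_path[OF d(4) ne' dist'] by (intro simple_path_join_loop) auto
  then show "simple_path (walk_path \<gamma> ds)"
    using d(1) ne' by (cases ds') (auto simp: dart_simps)
qed

text \<open>A counter-clockwise cycle has its inside on the left, a clockwise one its outside.\<close>

definition left_side :: "(complex, 'e) dart list \<Rightarrow> complex set" where
  "left_side ds =
     (if \<forall>z\<in>inside (path_image (walk_path \<gamma> ds)). winding_number (walk_path \<gamma> ds) z = 1
      then inside (path_image (walk_path \<gamma> ds)) else outside (path_image (walk_path \<gamma> ds)))"

lemma left_side_cases: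
  assumes "cycle_walk G ds"
  obtains "left_side ds = inside (cycle_image \<gamma> (dart_edge ` set ds))"
      "\<And>z. z \<in> inside (cycle_image \<gamma> (dart_edge ` set ds)) \<Longrightarrow> winding_number (walk_path \<gamma> ds) z = 1"
    | "left_side ds = outside (cycle_image \<gamma> (dart_edge ` set ds))"
      "\<And>z. z \<in> inside (cycle_image \<gamma> (dart_edge ` set ds)) \<Longrightarrow> winding_number (walk_path \<gamma> ds) z = - 1"
proof -
  note w = cycle_walk_path[OF assms]
  \<comment> \<open>The inside is nonempty; otherwise the test in \<open>left_side\<close> would
    hold vacuously also in the clockwise case.\<close>
  obtain z where z: "z \<in> inside (path_image (walk_path \<gamma> ds))"
    using Jordan_inside_outside[OF w(1,2)] by blast
  show ?thesis
  proof (rule simple_closed_path_winding_number_inside[OF w(1)])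
    assume "\<And>z. z \<in> inside (path_image (walk_path \<gamma> ds)) \<Longrightarrow> winding_number (walk_path \<gamma> ds) z = 1"
    then show ?thesis using w(3) by (intro that(1)) (auto simp: left_side_def)
  next
    assume *: "\<And>z. z \<in> inside (path_image (walk_path \<gamma> ds)) \<Longrightarrow> winding_number (walk_path \<gamma> ds) z = - 1"
    then have "\<not> (\<forall>z\<in>inside (path_image (walk_path \<gamma> ds)). winding_number (walk_path \<gamma> ds) z = 1)"
      using z by force
    then show ?thesis using w(3) * by (intro that(2)) (auto simp: left_side_def)
  qed
qed

text \<open>Reversal negates winding numbers, and on the inside these are 1 or -1, so a walk and its
  reverse have opposite sides.\<close>

lemma left_side_reverse:
  assumes "cycle_walk G ds"
  shows "left_side ds = inside (cycle_image \<gamma> (dart_edge ` set ds)) \<and>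
      left_side (reverse_walk ds) = outside (cycle_image \<gamma> (dart_edge ` set ds)) \<or>
    left_side ds = outside (cycle_image \<gamma> (dart_edge ` set ds)) \<and>
      left_side (reverse_walk ds) = inside (cycle_image \<gamma> (dart_edge ` set ds))"
proof -
  let ?S = "cycle_image \<gamma> (dart_edge ` set ds)"
  note w = cycle_walk_path[OF assms]
  note w' = cycle_walk_path[OF cycle_walk_reverse[OF assms]]
  have E: "dart_edge ` set (reverse_walk ds) = dart_edge ` set ds"
    by (rule edges_reverse_walk)
  \<comment> \<open>In general the path of the reversed walk is not the reversed path, because the
    joins are nested differently. The sums over darts are compared instead.\<close>
  have neg: "winding_number (walk_path \<gamma> (reverse_walk ds)) z = - winding_number (walk_path \<gamma> ds) z"
    if z: "z \<in> inside ?S" for z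
  proof -
    have zS: "z \<notin> ?S" using z inside_no_overlap by blast
    have "winding_number (walk_path \<gamma> (reverse_walk ds)) z =
      (\<Sum>d\<in>(\<lambda>(a, e, b). (b, e, a)) ` set ds. winding_number (curve_from \<gamma> (dart_tail d) (dart_edge d)) z)"
      using w'(4)[of z] zS E by (simp add: set_reverse_walk)
    also have "\<dots> = (\<Sum>d\<in>set ds. winding_number (curve_from \<gamma> (dart_head d) (dart_edge d)) z)"
      by (subst sum.reindex)
        (auto simp: inj_on_def dart_tail_def dart_edge_def dart_head_def case_prod_unfold)
    also have "\<dots> = (\<Sum>d\<in>set ds. - winding_number (curve_from \<gamma> (dart_tail d) (dart_edge d)) z)"
    proof (rule sum.cong)
      fix d assume d: "d \<in> set ds"
      obtain a g b where abg: "d = (a, g, b)" by (cases d)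
      then have g: "g \<in> edges G" "ends G g = {a, b}" using cycle_walk_dart[OF assms] d by auto
      have "z \<notin> path_image (\<gamma> g)" using zS d abg by (force simp: cycle_image_def dart_simps)
      then show "winding_number (curve_from \<gamma> (dart_head d) (dart_edge d)) z =
          - winding_number (curve_from \<gamma> (dart_tail d) (dart_edge d)) z"
        using curve_from[OF g] abg by (simp add: dart_simps winding_number_reversepath)
    qed simp
    also have "\<dots> = - winding_number (walk_path \<gamma> ds) z"
      using w(4)[OF zS] by (simp add: sum_negf)
    finally show ?thesis .
  qed
  obtain z where z: "z \<in> inside ?S" using Jordan_inside_outside[OF w(1,2)] w(3) by auto
  show ?thesis
    by (rule left_side_cases[OF assms]; rule left_side_cases[OF cycle_walk_reverse[OF assms]])
      (use neg[OF z] z E in force)+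
qed

lemma connected_one_side:
  assumes "cycle_walk G ds" "connected X" "X \<inter> cycle_image \<gamma> (dart_edge ` set ds) = {}"
    and "z \<in> X" "z \<in> left_side ds"
  shows "X \<subseteq> left_side ds"
proof -
  let ?S = "cycle_image \<gamma> (dart_edge ` set ds)"
  note w = cycle_walk_path[OF assms(1)]
  have o: "open (inside ?S)" "open (outside ?S)"
    using Jordan_inside_outside[OF w(1,2)] w(3) by auto
  have u: "X \<subseteq> inside ?S \<union> outside ?S"
    using assms(3) inside_Un_outside[of ?S] by blast
  then have u': "x \<in> inside ?S \<or> x \<in> outside ?S" if "x \<in> X" for x
    using that by blast
  have "inside ?S \<inter> X = {} \<or> outside ?S \<inter> X = {}"
    using connectedD[OF assms(2) o _ u] inside_Int_outside[of ?S] by blast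
  moreover have "left_side ds = inside ?S \<or> left_side ds = outside ?S"
    using left_side_reverse[OF assms(1)] by metis
  ultimately show ?thesis using u' assms(4,5) by blast
qed

lemma open_edge_sides:
  assumes "cycle_walk G ds" "g \<in> edges G" "g \<notin> dart_edge ` set ds"
  shows "\<gamma> g ` {0<..<1} \<subseteq> left_side ds \<or> \<gamma> g ` {0<..<1} \<subseteq> left_side (reverse_walk ds)"
proof -
  let ?S = "cycle_image \<gamma> (dart_edge ` set ds)"
  have E: "dart_edge ` set (reverse_walk ds) = dart_edge ` set ds"
    by (rule edges_reverse_walk)
  have a: "\<gamma> g ` {0<..<1} \<inter> ?S = {}"
    by (rule open_edge_avoids[OF assms(2) cycle_walk_edges[OF assms(1)] assms(3)])
  have "continuous_on {0<..<1} (\<gamma> g)"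
    using arc_edge[OF assms(2)] by (auto simp: arc_def path_def intro: continuous_on_subset)
  then have c: "connected (\<gamma> g ` {0<..<1})" by (intro connected_continuous_image) auto
  have "\<gamma> g (1/2) \<in> \<gamma> g ` {0<..<1}" by auto
  moreover from this have "\<gamma> g (1/2) \<in> inside ?S \<union> outside ?S"
    using a inside_Un_outside[of ?S] by blast
  then have "\<gamma> g (1/2) \<in> left_side ds \<or> \<gamma> g (1/2) \<in> left_side (reverse_walk ds)"
    using left_side_reverse[OF assms(1)] by blast
  moreover note connected_one_side[OF assms(1) c a]
    connected_one_side[OF cycle_walk_reverse[OF assms(1)] c a[folded E]]
  ultimately show ?thesis by blast
qed

section \<open>Edges in a small disc about a vertex of the cycle\<close>

lemma connecting_path:
  assumes "dart_walk G u ds w"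
  obtains M where "path M" "pathstart M = u" "pathfinish M = w"
    "path_image M \<subseteq> insert u (cycle_image \<gamma> (dart_edge ` set ds))"
    "\<forall>z. z \<notin> insert u (cycle_image \<gamma> (dart_edge ` set ds)) \<longrightarrow>
       winding_number M z = (\<Sum>d\<leftarrow>ds. winding_number (curve_from \<gamma> (dart_tail d) (dart_edge d)) z)"
proof (cases "ds = []")
  case True
  \<comment> \<open>This case arises for a cycle of two parallel edges. A constant path at
    \<open>u\<close> is supplied, since \<open>walk_path\<close> of the empty list sits at the
    origin.\<close>
  then show ?thesis using assms by (intro that[of "linepath u u"]) auto
next
  case False
  then show ?thesis using walk_path[OF assms False] winding_number_walk_path[OF assms False]
    by (intro that[of "walk_path \<gamma> ds"]) auto
qed

text \<open>The parameters at distance \<open>r\<close> form a closed set, nonempty because the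
  other end lies farther away than \<open>r\<close>; so the infimum is attained. By the intermediate
  value theorem the curve stays inside the disc before it.\<close>

lemma exit_point:
  assumes g: "g \<in> edges G" "ends G g = {v, w}" and r: "0 < r" "r < dist v w"
  obtains t where "0 < t" "t < 1" "curve_from \<gamma> v g t = exit_point \<gamma> v r g"
    "dist v (exit_point \<gamma> v r g) = r" "\<And>s. 0 \<le> s \<Longrightarrow> s < t \<Longrightarrow> dist v (curve_from \<gamma> v g s) < r"
proof -
  define h where "h = curve_from \<gamma> v g"
  note c = curve_from[OF g, folded h_def]
  have h01: "h 0 = v" "h 1 = w" using c by (auto simp: pathstart_def pathfinish_def)
  have cont: "continuous_on {0..1} h" using c(9) by (simp add: path_def)
  then have contd: "continuous_on {0..1} (\<lambda>t. dist v (h t))" by (intro continuous_intros)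
  define S where "S = {t \<in> {0..1}. dist v (h t) = r}"
  have "S = {0..1} \<inter> (\<lambda>t. dist v (h t)) -` {r}" by (auto simp: S_def)
  then have clS: "closed S"
    using continuous_closed_preimage[OF contd closed_atLeastAtMost closed_singleton] by simp
  have ivt: "\<exists>x\<in>S. x \<le> s" if s: "0 \<le> s" "s \<le> 1" "r \<le> dist v (h s)" for s
  proof -
    have "\<exists>x. 0 \<le> x \<and> x \<le> s \<and> dist v (h x) = r"
      using s r h01 continuous_on_subset[OF contd, of "{0..s}"] by (intro IVT') auto
    then show ?thesis using s by (auto simp: S_def)
  qed
  have neS: "S \<noteq> {}" using ivt[of 1] r h01 by auto
  have bdd: "bdd_below S" by (intro bdd_belowI[of _ 0]) (auto simp: S_def)
  define t where "t = Inf S"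
  have tS: "t \<in> S" unfolding t_def by (rule closed_contains_Inf[OF neS bdd clS])
  have ht: "exit_point \<gamma> v r g = h t" by (simp add: exit_point_def h_def t_def S_def)
  have "t \<noteq> 0" "t \<noteq> 1" using tS r h01 by (auto simp: S_def)
  then have "0 < t" "t < 1" using tS by (auto simp: S_def)
  moreover have "dist v (h s) < r" if s: "0 \<le> s" "s < t" for s
  proof (rule ccontr)
    assume "\<not> ?thesis"
    then obtain x where "x \<in> S" "x \<le> s" using ivt[of s] s \<open>t < 1\<close> by force
    then show False using cInf_lower[OF _ bdd, of x] s by (simp add: t_def)
  qed
  ultimately show ?thesis using that[of t] ht tS by (auto simp: h_def S_def)
qed

lemma cycle_walk_at:
  assumes cw: "cycle_walk G ds" and "(a1, a, v) \<in> set ds" "(v, b, b1) \<in> set ds"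
  obtains mid where "cycle_walk G ((v, b, b1) # mid @ [(a1, a, v)])"
    "set ((v, b, b1) # mid @ [(a1, a, v)]) = set ds"
proof -
  obtain ys where ys: "cycle_walk G ((v, b, b1) # ys)" "set ((v, b, b1) # ys) = set ds"
    using cycle_walk_from[OF cw assms(3)] .
  have ne: "a1 \<noteq> v" "b1 \<noteq> v"
    using cycle_walk_dart[OF cw assms(2)] cycle_walk_dart[OF cw assms(3)] by auto
  have w: "dart_walk G b1 ys v" using ys(1) by (auto simp: cycle_walk_iff)
  then have "ys \<noteq> []" using ne by auto
  then obtain mid l where l: "ys = mid @ [l]" by (meson rev_exhaust)
  obtain l1 lg l2 where ll: "l = (l1, lg, l2)" by (cases l)
  have "l2 = v" using w l ll by (auto simp: dart_walk_append)
  then have "(l1, lg, v) \<in> set ds" using ys(2) l ll by auto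
  then have "(l1, lg, v) = (a1, a, v)" using cycle_walk_unique[OF cw _ assms(2)] by blast
  then show ?thesis using that[of mid] ys l ll \<open>l2 = v\<close> by auto
qed

lemma exit_initial_piece:
  assumes g: "g \<in> edges G" "ends G g = {v, w}" and r: "0 < r" "r < dist v w"
  obtains t where "0 < t" "t < 1" "curve_from \<gamma> v g t = exit_point \<gamma> v r g"
    "dist v (exit_point \<gamma> v r g) = r"
    "arc (subpath 0 t (curve_from \<gamma> v g))" "pathstart (subpath 0 t (curve_from \<gamma> v g)) = v"
    "pathfinish (subpath 0 t (curve_from \<gamma> v g)) = exit_point \<gamma> v r g"
    "path_image (subpath 0 t (curve_from \<gamma> v g)) \<subseteq> insert (exit_point \<gamma> v r g) (ball v r)"
    "path_image (subpath 0 t (curve_from \<gamma> v g)) \<subseteq> path_image (\<gamma> g)"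
    "path_image (subpath 0 t (curve_from \<gamma> v g)) = curve_from \<gamma> v g ` {0..t}"
proof -
  obtain t where t: "0 < t" "t < 1" "curve_from \<gamma> v g t = exit_point \<gamma> v r g"
    "dist v (exit_point \<gamma> v r g) = r" "\<And>s. 0 \<le> s \<Longrightarrow> s < t \<Longrightarrow> dist v (curve_from \<gamma> v g s) < r"
    using exit_point[OF g r] by blast
  note c = curve_from[OF g]
  have im: "path_image (subpath 0 t (curve_from \<gamma> v g)) = curve_from \<gamma> v g ` {0..t}"
    using t(1) by (simp add: path_image_subpath)
  show ?thesis
  proof (rule that[OF t(1-4)])
    show "arc (subpath 0 t (curve_from \<gamma> v g))"
      using t(1,2) c(1) by (intro arc_subpath_arc) auto
    show "pathstart (subpath 0 t (curve_from \<gamma> v g)) = v"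
      using c(2) by (simp add: pathstart_def subpath_def)
    show "pathfinish (subpath 0 t (curve_from \<gamma> v g)) = exit_point \<gamma> v r g"
      using t(3) by simp
    show "path_image (subpath 0 t (curve_from \<gamma> v g)) \<subseteq> insert (exit_point \<gamma> v r g) (ball v r)"
    proof
      fix z assume "z \<in> path_image (subpath 0 t (curve_from \<gamma> v g))"
      then obtain s where s: "0 \<le> s" "s \<le> t" "z = curve_from \<gamma> v g s" unfolding im by auto
      then show "z \<in> insert (exit_point \<gamma> v r g) (ball v r)"
        using t(3) t(5)[of s] by (cases "s = t") auto
    qed
    have "curve_from \<gamma> v g ` {0..t} \<subseteq> path_image (curve_from \<gamma> v g)"
      using t(1,2) by (auto simp: path_image_def)
    then show "path_image (subpath 0 t (curve_from \<gamma> v g)) \<subseteq> path_image (\<gamma> g)"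
      using c(4) im by simp
  qed (rule im)
qed

text \<open>The crosscut lemma is applied to the initial pieces of \<open>a\<close> and
  \<open>b\<close>. The initial piece of \<open>f\<close> leads from its exit point on the left arc
  to points near \<open>v\<close>, which therefore have winding number \<open>K\<close>; points of
  the inside and the outside near \<open>v\<close> determine \<open>K\<close>.\<close>

lemma edge_on_left:
  assumes cw: "cycle_walk G ds" and a: "(a1, a, v) \<in> set ds" and b: "(v, b, b1) \<in> set ds"
    and f: "f \<in> edges G" "ends G f = {v, f1}" "f \<notin> dart_edge ` set ds"
    and r: "0 < r" "r < dist v a1" "r < dist v b1" "r < dist v f1"
    and ang: "0 < ccw_angle v (exit_point \<gamma> v r b) (exit_point \<gamma> v r f)"
      "ccw_angle v (exit_point \<gamma> v r b) (exit_point \<gamma> v r f)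
        < ccw_angle v (exit_point \<gamma> v r b) (exit_point \<gamma> v r a)"
  shows "\<gamma> f ` {0<..<1} \<subseteq> left_side ds"
proof -
  obtain mid where mid: "cycle_walk G ((v, b, b1) # mid @ [(a1, a, v)])"
    "set ((v, b, b1) # mid @ [(a1, a, v)]) = set ds"
    using cycle_walk_at[OF cw a b] .
  let ?S = "cycle_image \<gamma> (dart_edge ` set ds)"
  have E: "dart_edge ` set ds = insert b (insert a (dart_edge ` set mid))"
    unfolding mid(2)[symmetric] by (auto simp: dart_simps)
  then have S: "?S = path_image (\<gamma> b) \<union> path_image (\<gamma> a) \<union> cycle_image \<gamma> (dart_edge ` set mid)"
    by (auto simp: cycle_image_def)
  have aG: "a \<in> edges G" "ends G a = {v, a1}" and bG: "b \<in> edges G" "ends G b = {v, b1}"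
    and ne: "a1 \<noteq> v" "b1 \<noteq> v" and vG: "v \<in> verts G"
    using cycle_walk_dart[OF cw a] cycle_walk_dart[OF cw b] by (auto simp: insert_commute)
  have w: "dart_walk G b1 mid a1" and dist: "distinct (map dart_tail ((v, b, b1) # mid @ [(a1, a, v)]))"
    "distinct (map dart_edge ((v, b, b1) # mid @ [(a1, a, v)]))"
    using mid(1) by (auto simp: cycle_walk_iff dart_walk_append)
  have fab: "f \<noteq> a" "f \<noteq> b" "a \<noteq> b" using f(3) E dist by (auto simp: dart_simps)
  note ca = curve_from[OF aG] and cb = curve_from[OF bG] and cf = curve_from[OF f(1,2)]
  let ?ha = "curve_from \<gamma> v a" and ?hb = "curve_from \<gamma> v b" and ?hf = "curve_from \<gamma> v f"
  obtain ta where ta: "0 < ta" "ta < 1" "?ha ta = exit_point \<gamma> v r a"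
    "dist v (exit_point \<gamma> v r a) = r"
    "arc (subpath 0 ta ?ha)" "pathstart (subpath 0 ta ?ha) = v"
    "pathfinish (subpath 0 ta ?ha) = exit_point \<gamma> v r a"
    "path_image (subpath 0 ta ?ha) \<subseteq> insert (exit_point \<gamma> v r a) (ball v r)"
    "path_image (subpath 0 ta ?ha) \<subseteq> path_image (\<gamma> a)"
    "path_image (subpath 0 ta ?ha) = ?ha ` {0..ta}"
    using exit_initial_piece[OF aG r(1,2)] .
  obtain tb where tb: "0 < tb" "tb < 1" "?hb tb = exit_point \<gamma> v r b"
    "dist v (exit_point \<gamma> v r b) = r"
    "arc (subpath 0 tb ?hb)" "pathstart (subpath 0 tb ?hb) = v"
    "pathfinish (subpath 0 tb ?hb) = exit_point \<gamma> v r b"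
    "path_image (subpath 0 tb ?hb) \<subseteq> insert (exit_point \<gamma> v r b) (ball v r)"
    "path_image (subpath 0 tb ?hb) \<subseteq> path_image (\<gamma> b)"
    "path_image (subpath 0 tb ?hb) = ?hb ` {0..tb}"
    using exit_initial_piece[OF bG r(1,3)] .
  obtain tf where tf: "0 < tf" "tf < 1" "?hf tf = exit_point \<gamma> v r f"
    "dist v (exit_point \<gamma> v r f) = r"
    "arc (subpath 0 tf ?hf)" "pathstart (subpath 0 tf ?hf) = v"
    "pathfinish (subpath 0 tf ?hf) = exit_point \<gamma> v r f"
    "path_image (subpath 0 tf ?hf) \<subseteq> insert (exit_point \<gamma> v r f) (ball v r)"
    "path_image (subpath 0 tf ?hf) \<subseteq> path_image (\<gamma> f)"
    "path_image (subpath 0 tf ?hf) = ?hf ` {0..tf}"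
    using exit_initial_piece[OF f(1,2) r(1,4)] .
  define A where "A = subpath 0 ta ?ha"
  define B where "B = subpath 0 tb ?hb"
  define A' where "A' = subpath ta 1 ?ha"
  define B' where "B' = subpath tb 1 ?hb"
  obtain M where M: "path M" "pathstart M = b1" "pathfinish M = a1"
    "path_image M \<subseteq> insert b1 (cycle_image \<gamma> (dart_edge ` set mid))"
    "\<forall>z. z \<notin> insert b1 (cycle_image \<gamma> (dart_edge ` set mid)) \<longrightarrow>
       winding_number M z = (\<Sum>d\<leftarrow>mid. winding_number (curve_from \<gamma> (dart_tail d) (dart_edge d)) z)"
    using connecting_path[OF w] .
  define Z where "Z = B' +++ (M +++ reversepath A')"
  have A': "path A'" "pathstart A' = exit_point \<gamma> v r a" "pathfinish A' = a1"
    "path_image A' = ?ha ` {ta..1}"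
    using ta(1-3) ca by (auto simp: A'_def path_image_subpath pathfinish_def[of ?ha])
  have B': "path B'" "pathstart B' = exit_point \<gamma> v r b" "pathfinish B' = b1"
    "path_image B' = ?hb ` {tb..1}"
    using tb(1-3) cb by (auto simp: B'_def path_image_subpath pathfinish_def[of ?hb])
  have Z: "path Z" "pathstart Z = pathfinish B" "pathfinish Z = pathfinish A"
    using A' B' M ta tb by (auto simp: Z_def A_def B_def)
  have imZ: "path_image Z = path_image B' \<union> path_image M \<union> path_image A'"
    using A' B' M by (simp add: Z_def path_image_join Un_assoc)
  have A'S: "path_image A' \<subseteq> path_image (\<gamma> a)" and B'S: "path_image B' \<subseteq> path_image (\<gamma> b)"
    using ta(1,2) tb(1,2) ca(4) cb(4) A'(4) B'(4) by (auto simp: path_image_def)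
  have b1S: "b1 \<in> path_image (\<gamma> b)" using cb(3,4) by (metis pathfinish_in_path_image)
  have v0: "?ha 0 = v" "?hb 0 = v" "?hf 0 = v"
    using ca(2) cb(2) cf(2) by (auto simp: pathstart_def)
  \<comment> \<open>The rest of the cycle misses \<open>v\<close> because the edge curves are
    injective and the cycle passes through \<open>v\<close> only once.\<close>
  have vZ: "v \<notin> path_image Z"
  proof -
    have "v \<notin> ?ha ` {ta..1}"
    proof
      assume "v \<in> ?ha ` {ta..1}"
      then obtain t where "ta \<le> t" "t \<le> 1" "?ha 0 = ?ha t" using v0(1) by auto
      then show False using curve_from_inj[OF aG, of 0 t] ta(1) by simp
    qed
    moreover have "v \<notin> ?hb ` {tb..1}"
    proof
      assume "v \<in> ?hb ` {tb..1}"
      then obtain t where "tb \<le> t" "t \<le> 1" "?hb 0 = ?hb t" using v0(2) by auto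
      then show False using curve_from_inj[OF bG, of 0 t] tb(1) by simp
    qed
    moreover have "v \<notin> cycle_image \<gamma> (dart_edge ` set mid)"
    proof
      assume "v \<in> cycle_image \<gamma> (dart_edge ` set mid)"
      then obtain c1 c c2 where c: "(c1, c, c2) \<in> set mid" "v \<in> path_image (\<gamma> c)"
        by (rule in_cycle_image_darts)
      then have "(c1, c, c2) \<in> set ds" using mid(2) by auto
      from cycle_walk_dart[OF cw this] have "v = c1 \<or> v = c2"
        using vertex_on_edge[of c v] vG c(2) by auto
      moreover have "c1 \<in> set (map dart_tail mid)" using imageI[OF c(1), of dart_tail] by (simp add: dart_simps)
      moreover have "c2 \<in> set (map dart_tail mid @ [a1])"
        using arg_cong[OF dart_walk_verts[OF w], of set] imageI[OF c(1), of dart_head]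
        by (auto simp: dart_simps)
      ultimately show False using dist(1) ne by (auto simp: dart_simps)
    qed
    ultimately show ?thesis using imZ A'(4) B'(4) M(4) ne by auto
  qed
  obtain \<theta> where \<theta>: "exit_point \<gamma> v r b = v + of_real r * cis \<theta>"
    using polar_form_on_circle[OF r(1) tb(4)] .
  define \<omega> where "\<omega> = ccw_angle v (exit_point \<gamma> v r b) (exit_point \<gamma> v r a)"
  define \<phi> where "\<phi> = ccw_angle v (exit_point \<gamma> v r b) (exit_point \<gamma> v r f)"
  have pa: "exit_point \<gamma> v r a = v + of_real r * cis (\<theta> + \<omega>)"
    unfolding \<omega>_def by (rule ccw_angle_cis[OF r(1) ta(4) \<theta>])
  have pf: "exit_point \<gamma> v r f = v + of_real r * cis (\<theta> + \<phi>)"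
    unfolding \<phi>_def by (rule ccw_angle_cis[OF r(1) tf(4) \<theta>])
  \<comment> \<open>Two edges meet only in common ends. The other end \<open>h1\<close> lies beyond
    distance \<open>r\<close>, so within the disc they can share only \<open>v\<close>.\<close>
  have small: "z = v" if "z \<in> path_image (\<gamma> g)" "z \<in> path_image (\<gamma> h)" "g \<noteq> h" "g \<in> edges G" "h \<in> edges G"
    "ends G h = {v, h1}" "r < dist v h1" "dist v z \<le> r" for z g h h1
    using edges_meet(3)[OF that(4,5,3,1,2)] that(6-8) by auto
  have imA: "path_image A \<subseteq> cball v r" and imB: "path_image B \<subseteq> cball v r"
    using ta(4,8) tb(4,8) r(1) by (force simp: A_def B_def)+
  have AB: "path_image A \<inter> path_image B = {v}"
  proof
    show "path_image A \<inter> path_image B \<subseteq> {v}"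
    proof
      fix z assume "z \<in> path_image A \<inter> path_image B"
      then have "z \<in> path_image (\<gamma> a)" "z \<in> path_image (\<gamma> b)" "dist v z \<le> r"
        using ta(9) tb(9) imA by (auto simp: A_def B_def)
      then show "z \<in> {v}" using small[of z a b b1] fab aG bG r by simp
    qed
    have "v \<in> path_image A" "v \<in> path_image B"
      using ta(6) tb(6) unfolding A_def B_def by (metis pathstart_in_path_image)+
    then show "{v} \<subseteq> path_image A \<inter> path_image B" by simp
  qed
  have \<omega>: "\<omega> < 2 * pi" unfolding \<omega>_def by (rule ccw_angle_bounds)
  have \<phi>: "0 < \<phi>" "\<phi> < \<omega>" using ang by (simp_all add: \<phi>_def \<omega>_def)
  have B: "arc B" "pathstart B = v" "pathfinish B = v + of_real r * cis \<theta>"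
    "path_image B \<subseteq> insert (pathfinish B) (ball v r)"
    using tb(5-8) \<theta> by (simp_all only: B_def)
  have A: "arc A" "pathstart A = v" "pathfinish A = v + of_real r * cis (\<theta> + \<omega>)"
    "path_image A \<subseteq> insert (pathfinish A) (ball v r)"
    using ta(5-8) pa by (simp_all only: A_def)
  obtain \<delta> K where \<delta>: "0 < \<delta>"
    and K: "\<forall>z\<in>ball v \<delta> - (path_image A \<union> path_image B).
       winding_number B z + winding_number Z z - winding_number A z \<in> {K, K - 1}"
    and KQ: "\<forall>Q. connected Q \<and> Q \<subseteq> insert (v + of_real r * cis (\<theta> + \<phi>)) (ball v r) \<and>
       v + of_real r * cis (\<theta> + \<phi>) \<in> Q \<and> Q \<inter> (path_image A \<union> path_image B) = {} \<longrightarrow>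
       (\<forall>z\<in>Q \<inter> ball v \<delta>. winding_number B z + winding_number Z z - winding_number A z = K)"
    using winding_number_left_of_crosscut[OF r(1) \<omega> \<phi> B A AB Z vZ] .
  define W where "W z = winding_number (walk_path \<gamma> ds) z" for z
  have W: "W z = winding_number B z + winding_number Z z - winding_number A z" if z: "z \<notin> ?S" for z
  proof -
    have za: "z \<notin> path_image ?ha" "z \<notin> path_image ?hb" using z S ca(4) cb(4) by auto
    have zM: "z \<notin> insert b1 (cycle_image \<gamma> (dart_edge ` set mid))"
      using z b1S unfolding S by blast
    have d: "distinct ((v, b, b1) # mid @ [(a1, a, v)])"
      using mid(1) by (auto simp: cycle_walk_iff distinct_map)
    have "W z = (\<Sum>d\<in>set ((v, b, b1) # mid @ [(a1, a, v)]).
        winding_number (curve_from \<gamma> (dart_tail d) (dart_edge d)) z)"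
      unfolding W_def mid(2) by (rule cycle_walk_path(4)[OF cw z])
    also have "\<dots> = (\<Sum>d\<leftarrow>(v, b, b1) # mid @ [(a1, a, v)].
        winding_number (curve_from \<gamma> (dart_tail d) (dart_edge d)) z)"
      using d by (rule sum_list_distinct_conv_sum_set[symmetric])
    also have "\<dots> = winding_number ?hb z + winding_number M z + winding_number (curve_from \<gamma> a1 a) z"
      by (simp add: M(5)[rule_format, OF zM] dart_simps)
    also have "winding_number (curve_from \<gamma> a1 a) z = - winding_number ?ha z"
      using ca(5,9) za by (simp add: winding_number_reversepath)
    also have "winding_number ?hb z = winding_number B z + winding_number B' z"
      using winding_number_subpath_combine[OF cb(9) za(2), of 0 tb 1] tb(1,2) by (simp add: B_def B'_def)
    also have "winding_number ?ha z = winding_number A z + winding_number A' z"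
      using winding_number_subpath_combine[OF ca(9) za(1), of 0 ta 1] ta(1,2) by (simp add: A_def A'_def)
    also have "winding_number B z + winding_number B' z + winding_number M z
        + - (winding_number A z + winding_number A' z) =
      winding_number B z + winding_number Z z - winding_number A z"
    proof -
      have "z \<notin> path_image M" "z \<notin> path_image A'" "z \<notin> path_image B'"
        using z S M(4) A'S B'S b1S by auto
      then have "winding_number Z z = winding_number B' z + (winding_number M z - winding_number A' z)"
        using A' B' M unfolding Z_def
        by (simp add: winding_number_join winding_number_reversepath path_image_join)
      then show ?thesis by simp
    qed
    finally show ?thesis .
  qed
  have SAB: "path_image A \<union> path_image B \<subseteq> ?S"
    using ta(9) tb(9) S by (auto simp: A_def B_def)
  have "v \<in> ?S" using SAB AB by blast
  note wp = cycle_walk_path[OF cw]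
  have J: "inside ?S \<noteq> {}" "open (inside ?S)" "open (outside ?S)"
    "frontier (inside ?S) = ?S" "frontier (outside ?S) = ?S"
    using Jordan_inside_outside[OF wp(1,2)] wp(3) by auto
  \<comment> \<open>Both sides of a Jordan curve have the whole curve as frontier, so each of them
    comes arbitrarily close to \<open>v\<close>.\<close>
  have near: "\<exists>z\<in>R. z \<in> ball v \<delta>" if "frontier R = ?S" for R
  proof -
    have "v \<in> closure R" using that \<open>v \<in> ?S\<close> by (auto simp: frontier_def)
    then show ?thesis using \<delta> unfolding closure_approachable by (auto simp: dist_commute)
  qed
  obtain zi zo where zi: "zi \<in> inside ?S" "zi \<in> ball v \<delta>" and zo: "zo \<in> outside ?S" "zo \<in> ball v \<delta>"
    using near[OF J(4)] near[OF J(5)] by metis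
  have zS: "zi \<notin> ?S" "zo \<notin> ?S" using zi zo inside_no_overlap outside_no_overlap by blast+
  have Wo: "W z = 0" if "z \<in> outside ?S" for z
    unfolding W_def using that wp simple_path_imp_path
    by (intro winding_number_zero_in_outside) auto
  \<comment> \<open>The outside point leaves \<open>K\<close> = 0 or \<open>K\<close> = 1. An inside
    value of 1 then forces \<open>K = 1\<close>, and an inside value of -1 forces
    \<open>K = 0\<close>.\<close>
  have K2: "W zi \<in> {K, K - 1}" "0 \<in> {K, K - 1}"
    using bspec[OF K, of zi] bspec[OF K, of zo] W[OF zS(1)] W[OF zS(2)] zi zo zS SAB Wo[OF zo(1)]
    by auto
  have "\<exists>s>0. s < tf \<and> ?hf s \<in> ball v \<delta>"
  proof -
    have "continuous_on {0..1} ?hf" using cf(9) by (simp add: path_def)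
    then have "continuous (at 0 within {0..1}) ?hf" by (simp add: continuous_on_eq_continuous_within)
    then obtain d where d: "d > 0" "\<And>s. s \<in> {0..1} \<Longrightarrow> dist s 0 < d \<Longrightarrow> dist (?hf s) (?hf 0) < \<delta>"
      using \<delta> unfolding continuous_within_eps_delta by blast
    define s where "s = min (d / 2) (tf / 2)"
    have "0 < s" "s < tf" "s < d" using d(1) tf(1) by (auto simp: s_def)
    then show ?thesis using d(2)[of s] tf(2) v0(3) by (auto simp: dist_commute)
  qed
  then obtain s where s: "0 < s" "s < tf" "?hf s \<in> ball v \<delta>" by auto
  have openf: "?hf s \<in> \<gamma> f ` {0<..<1}"
    using s tf(2) curve_from_open_image[OF f(1,2)] by (metis greaterThanLessThan_iff imageI less_trans)
  have avoid: "\<gamma> f ` {0<..<1} \<inter> ?S = {}"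
    by (rule open_edge_avoids[OF f(1) cycle_walk_edges[OF cw] f(3)])
  have WK: "W (?hf s) = K"
  proof -
    have "winding_number B (?hf s) + winding_number Z (?hf s) - winding_number A (?hf s) = K"
    \<comment> \<open>The half-open parameter interval omits \<open>v\<close>, which lies on the
      cycle, and keeps the exit point, where the crosscut lemma starts.\<close>
    proof (rule KQ[rule_format, where Q = "?hf ` {0<..tf}"], intro conjI)
      have "continuous_on {0<..tf} ?hf"
        using cf(9) unfolding path_def by (rule continuous_on_subset) (use tf(2) in auto)
      then show "connected (?hf ` {0<..tf})" by (intro connected_continuous_image) auto
      show "?hf ` {0<..tf} \<subseteq> insert (v + of_real r * cis (\<theta> + \<phi>)) (ball v r)"
        using tf(8) unfolding tf(10) pf by (rule order_trans[rotated]) auto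
      show "v + of_real r * cis (\<theta> + \<phi>) \<in> ?hf ` {0<..tf}"
        using tf(1,3) pf by (auto intro!: image_eqI[of _ _ tf])
      have "?hf ` {0<..tf} \<subseteq> ?hf ` {0<..<1}" using tf(2) by auto
      then have "?hf ` {0<..tf} \<inter> ?S = {}"
        using avoid curve_from_open_image[OF f(1,2)] by auto
      then show "?hf ` {0<..tf} \<inter> (path_image A \<union> path_image B) = {}" using SAB by blast
    qed (use s in auto)
    then show ?thesis using W[of "?hf s"] openf avoid by auto
  qed
  have hs: "?hf s \<in> left_side ds"
  proof (rule left_side_cases[OF cw])
    assume *: "left_side ds = inside ?S" "\<And>z. z \<in> inside ?S \<Longrightarrow> winding_number (walk_path \<gamma> ds) z = 1"
    have "W zi = 1" using *(2) zi by (simp add: W_def)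
    then have "K = 1" using K2 by auto
    then have "?hf s \<notin> outside ?S" using Wo[of "?hf s"] WK by auto
    moreover have "?hf s \<notin> ?S" using openf avoid by auto
    ultimately show ?thesis using inside_Un_outside[of ?S] *(1) by blast
  next
    assume *: "left_side ds = outside ?S" "\<And>z. z \<in> inside ?S \<Longrightarrow> winding_number (walk_path \<gamma> ds) z = - 1"
    have "W zi = - 1" using *(2) zi by (simp add: W_def)
    then have "K = 0" using K2 by auto
    then have "?hf s \<notin> inside ?S" using *(2)[of "?hf s"] WK by (auto simp: W_def)
    moreover have "?hf s \<notin> ?S" using openf avoid by auto
    ultimately show ?thesis using inside_Un_outside[of ?S] *(1) by blast
  qed
  have "connected (\<gamma> f ` {0<..<1})"
  proof -
    have "continuous_on {0<..<1} (\<gamma> f)"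
      using arc_edge[OF f(1)] by (auto simp: arc_def path_def intro: continuous_on_subset)
    then show ?thesis by (intro connected_continuous_image) auto
  qed
  then show ?thesis using connected_one_side[OF cw _ avoid openf hs] by blast
qed

section \<open>The tour stays on the left of the cycle\<close>

lemma cycle_walk_tails_heads:
  assumes "cycle_walk G ds"
  shows "dart_tail ` set ds = dart_head ` set ds"
proof -
  obtain u where u: "dart_walk G u ds u"
    using assms by (auto simp: cycle_walk_iff)
  have "ds \<noteq> []" using assms by (auto simp: cycle_walk_iff)
  then obtain x xs where "map dart_tail ds = x # xs" by (cases ds) auto
  then have "x # xs @ [u] = u # map dart_head ds" using dart_walk_verts[OF u] by simp
  then have "set (map dart_head ds) = set (map dart_tail ds)"
    using \<open>map dart_tail ds = x # xs\<close> by (metis list.inject rotate1.simps(2) set_rotate1)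
  then show ?thesis by simp
qed

lemma cycle_walk_through:
  assumes cw: "cycle_walk G ds" and v: "v \<in> verts G" "v \<in> cycle_image \<gamma> (dart_edge ` set ds)"
  obtains a1 a b b1 where "(a1, a, v) \<in> set ds" "(v, b, b1) \<in> set ds"
proof -
  obtain c1 c c2 where c: "(c1, c, c2) \<in> set ds" "v \<in> path_image (\<gamma> c)"
    using in_cycle_image_darts[OF v(2)] .
  then have "v = c1 \<or> v = c2"
    using cycle_walk_dart[OF cw c(1)] vertex_on_edge[of c v] v(1) by auto
  moreover have "c1 \<in> dart_tail ` set ds" "c2 \<in> dart_head ` set ds"
    using imageI[OF c(1), of dart_tail] imageI[OF c(1), of dart_head] by (simp_all add: dart_simps)
  ultimately have "v \<in> dart_tail ` set ds" "v \<in> dart_head ` set ds"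
    using cycle_walk_tails_heads[OF cw] by auto
  then have "\<exists>d\<in>set ds. fst d = v" "\<exists>d\<in>set ds. snd (snd d) = v"
    unfolding dart_tail_def dart_head_def by (auto intro: rev_bexI)
  then show ?thesis using that by (metis prod.collapse)
qed

lemma incident_ends:
  assumes "v \<in> verts G" "g \<in> incident G v"
  obtains w where "g \<in> edges G" "ends G g = {v, w}" "other_end G g v = w" "v \<noteq> w"
    "(w, g) \<in> half_edges G" "other_end G g w = v"
proof -
  have "(v, g) \<in> half_edges G" using assms by (simp add: half_edges_def)
  from half_edge_cases[OF connected this] show ?thesis using that by metis
qed

text \<open>Two edges at \<open>v\<close>, together with \<open>v\<close>, form a connected set that
  misses the cycle. Their far ends are cut off, as these may lie on it.\<close>

lemma open_edges_at_vertex: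
  assumes cw: "cycle_walk G ds" and v: "v \<in> verts G" "v \<notin> cycle_image \<gamma> (dart_edge ` set ds)"
    and g: "g \<in> incident G v" "\<gamma> g ` {0<..<1} \<subseteq> left_side ds" and h: "h \<in> incident G v"
  shows "h \<notin> dart_edge ` set ds" "\<gamma> h ` {0<..<1} \<subseteq> left_side ds"
proof -
  let ?S = "cycle_image \<gamma> (dart_edge ` set ds)"
  have star: "connected (curve_from \<gamma> v k ` {0..<1}) \<and> curve_from \<gamma> v k ` {0..<1} \<inter> ?S = {}
      \<and> v \<in> curve_from \<gamma> v k ` {0..<1} \<and> \<gamma> k ` {0<..<1} \<subseteq> curve_from \<gamma> v k ` {0..<1}
      \<and> k \<notin> dart_edge ` set ds" if k: "k \<in> incident G v" for k
  proof -
    obtain w where k: "k \<in> edges G" "ends G k = {v, w}"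
      using incident_ends[OF v(1) k] by metis
    note c = curve_from[OF k]
    have "v \<in> path_image (\<gamma> k)" using c(2,4) by (metis pathstart_in_path_image)
    then have kC: "k \<notin> dart_edge ` set ds" using v(2) by (auto simp: cycle_image_def)
    have v0: "curve_from \<gamma> v k 0 = v" using c(2) by (simp add: pathstart_def)
    have "{0..<1::real} = insert 0 {0<..<1}" by auto
    then have im: "curve_from \<gamma> v k ` {0..<1} = insert v (\<gamma> k ` {0<..<1})"
      using curve_from_open_image[OF k] v0 by (metis image_insert)
    have "continuous_on {0..<1} (curve_from \<gamma> v k)"
      using c(9) unfolding path_def by (rule continuous_on_subset) auto
    then have "connected (curve_from \<gamma> v k ` {0..<1})" by (intro connected_continuous_image) auto
    then show ?thesis
      using kC v(2) open_edge_avoids[OF k(1) cycle_walk_edges[OF cw] kC] unfolding im by blast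
  qed
  let ?X = "curve_from \<gamma> v g ` {0..<1} \<union> curve_from \<gamma> v h ` {0..<1}"
  have "connected ?X" using star[OF g(1)] star[OF h] by (intro connected_Un) auto
  moreover have "?X \<inter> ?S = {}" using star[OF g(1)] star[OF h] by auto
  moreover have "\<gamma> g (1/2) \<in> \<gamma> g ` {0<..<1}" by auto
  then have "\<gamma> g (1/2) \<in> ?X" "\<gamma> g (1/2) \<in> left_side ds" using star[OF g(1)] g(2) by auto
  ultimately have "?X \<subseteq> left_side ds" by (rule connected_one_side[OF cw])
  then show "\<gamma> h ` {0<..<1} \<subseteq> left_side ds" using star[OF h] by blast
  show "h \<notin> dart_edge ` set ds" using star[OF h] by blast
qed

text \<open>A half-edge \<open>(v, g)\<close> stands for the corner at \<open>v\<close> that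
  precedes \<open>g\<close> in counter-clockwise order. On the cycle this corner is on the left when
  \<open>g\<close> enters \<open>v\<close> and on the right when \<open>g\<close> leaves
  \<open>v\<close>; hence only one of the two half-edges of a cycle edge belongs to the set.\<close>

definition left_half_edges :: "(complex, 'e) dart list \<Rightarrow> (complex \<times> 'e) set" where
  "left_half_edges ds = {(v, g). (\<exists>u. (u, g, v) \<in> set ds) \<or>
     g \<notin> dart_edge ` set ds \<and> \<gamma> g ` {0<..<1} \<subseteq> left_side ds}"

lemma left_side_disjoint_reverse:
  assumes "cycle_walk G ds"
  shows "left_side ds \<inter> left_side (reverse_walk ds) = {}"
  using left_side_reverse[OF assms] inside_Int_outside[of "cycle_image \<gamma> (dart_edge ` set ds)"]
  by (metis Int_commute)

text \<open>A single radius for which every edge at \<open>v\<close> leaves the disc and the exit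
  points show the order of the ribbon structure; finitely many eventual conditions are
  combined.\<close>

lemma small_radius:
  assumes ccw: "ccw_ribbon_structure G \<gamma> \<sigma>" and v: "v \<in> verts G"
  obtains r where "0 < r" "\<forall>h\<in>incident G v. r < dist v (other_end G h v)"
    "\<forall>h\<in>incident G v. \<forall>f\<in>incident G v - {h}.
        ccw_angle v (exit_point \<gamma> v r h) (exit_point \<gamma> v r (\<sigma> v h))
          \<le> ccw_angle v (exit_point \<gamma> v r h) (exit_point \<gamma> v r f)"
proof -
  have fin: "finite (incident G v)"
    using connected by (simp add: connected_graph_def incident_def)
  have "\<forall>\<^sub>F r in at_right 0. r < dist v (other_end G h v)" if h: "h \<in> incident G v" for h
  proof -
    have "0 < dist v (other_end G h v)" using incident_ends[OF v h] by (metis zero_less_dist_iff)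
    then show ?thesis by (rule eventually_mono[OF eventually_at_right_real]) simp
  qed
  then have "\<forall>\<^sub>F r in at_right 0. \<forall>h\<in>incident G v. r < dist v (other_end G h v)"
    by (intro eventually_ball_finite fin) auto
  moreover have "\<forall>\<^sub>F r in at_right 0. \<forall>h\<in>incident G v. \<forall>f\<in>incident G v - {h}.
        ccw_angle v (exit_point \<gamma> v r h) (exit_point \<gamma> v r (\<sigma> v h))
          \<le> ccw_angle v (exit_point \<gamma> v r h) (exit_point \<gamma> v r f)"
    using ccw v by (simp add: ccw_ribbon_structure_def)
  moreover have "\<forall>\<^sub>F r in at_right 0. (0::real) < r" by (rule eventually_at_right_less)
  ultimately have "\<forall>\<^sub>F r in at_right 0. 0 < r \<and> (\<forall>h\<in>incident G v. r < dist v (other_end G h v)) \<and>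
     (\<forall>h\<in>incident G v. \<forall>f\<in>incident G v - {h}.
        ccw_angle v (exit_point \<gamma> v r h) (exit_point \<gamma> v r (\<sigma> v h))
          \<le> ccw_angle v (exit_point \<gamma> v r h) (exit_point \<gamma> v r f))"
    by (intro eventually_conj)
  then have "\<exists>r. 0 < r \<and> (\<forall>h\<in>incident G v. r < dist v (other_end G h v)) \<and>
     (\<forall>h\<in>incident G v. \<forall>f\<in>incident G v - {h}.
        ccw_angle v (exit_point \<gamma> v r h) (exit_point \<gamma> v r (\<sigma> v h))
          \<le> ccw_angle v (exit_point \<gamma> v r h) (exit_point \<gamma> v r f))"
    by (rule eventually_happens'[OF trivial_limit_at_right_real])
  then show ?thesis by (elim exE conjE) (rule that)
qed

text \<open>Measure angles from the leaving edge \<open>b\<close>. The left-hand sector ends at the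
  entering edge \<open>a\<close>; a turn that starts at \<open>b\<close> or inside this sector
  cannot pass \<open>a\<close>, because \<open>a\<close> itself competes for being the next
  edge.\<close>

lemma left_half_edges_turn:
  assumes cw: "cycle_walk G ds" and ccw: "ccw_ribbon_structure G \<gamma> \<sigma>"
    and v: "v \<in> verts G" and g: "g \<in> incident G v"
    and left: "(\<exists>w. (v, g, w) \<in> set ds) \<or> g \<notin> dart_edge ` set ds \<and> \<gamma> g ` {0<..<1} \<subseteq> left_side ds"
  shows "(v, \<sigma> v g) \<in> left_half_edges ds"
proof -
  let ?S = "cycle_image \<gamma> (dart_edge ` set ds)"
  have rib: "ribbon_structure G \<sigma>" using ccw by (simp add: ccw_ribbon_structure_def)
  have \<sigma>g: "\<sigma> v g \<in> incident G v" by (rule ribbon_structure_incident[OF rib v g])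
  show ?thesis
  proof (cases "v \<in> ?S")
    case False
    have "\<nexists>w. (v, g, w) \<in> set ds"
    proof
      assume "\<exists>w. (v, g, w) \<in> set ds"
      then obtain w where w: "(v, g, w) \<in> set ds" by blast
      then have "v \<in> path_image (\<gamma> g)"
        using cycle_walk_dart[OF cw w] curve_from(2,4)[of g v w] by (metis pathstart_in_path_image)
      moreover have "g \<in> dart_edge ` set ds" using imageI[OF w, of dart_edge] by (simp add: dart_simps)
      ultimately show False using False by (auto simp: cycle_image_def)
    qed
    then show ?thesis
      using open_edges_at_vertex[OF cw v False g _ \<sigma>g] left by (auto simp: left_half_edges_def)
  next
    case True
    obtain a1 a b b1 where a: "(a1, a, v) \<in> set ds" and b: "(v, b, b1) \<in> set ds"
      using cycle_walk_through[OF cw v True] .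
    obtain r where r: "0 < r" "\<And>h. h \<in> incident G v \<Longrightarrow> r < dist v (other_end G h v)"
      and ccw_next: "\<And>h f. h \<in> incident G v \<Longrightarrow> f \<in> incident G v - {h} \<Longrightarrow>
        ccw_angle v (exit_point \<gamma> v r h) (exit_point \<gamma> v r (\<sigma> v h))
          \<le> ccw_angle v (exit_point \<gamma> v r h) (exit_point \<gamma> v r f)"
      using small_radius[OF ccw v] by metis
    define p where "p h = exit_point \<gamma> v r h" for h
    define ang where "ang h k = ccw_angle v (p h) (p k)" for h k
    have aG: "a \<in> edges G" "ends G a = {v, a1}" "a \<in> incident G v"
      and bG: "b \<in> edges G" "ends G b = {v, b1}" "b \<in> incident G v"
      using cycle_walk_dart[OF cw a] cycle_walk_dart[OF cw b] by (auto simp: insert_commute incident_def)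
    have other: "other_end G a v = a1" "other_end G b v = b1"
      using other_end_eq aG(2) bG(2) by metis+
    have ab: "a \<noteq> b"
      using cycle_walk_unique[OF cw a b] cycle_walk_dart(3)[OF cw a] by auto
    have p: "dist v (p h) = r" "p h \<noteq> v" "p h \<in> path_image (\<gamma> h)" if h: "h \<in> incident G v" for h
    proof -
      obtain w where w: "h \<in> edges G" "ends G h = {v, w}" "other_end G h v = w"
        using incident_ends[OF v h] by metis
      have "r < dist v w" using r(2)[OF h] w(3) by simp
      from exit_point[OF w(1,2) r(1) this] obtain t where t: "0 < t" "t < 1"
        "curve_from \<gamma> v h t = p h" "dist v (p h) = r" unfolding p_def by metis
      then show "dist v (p h) = r" "p h \<noteq> v" using r(1) by auto
      have "p h \<in> path_image (curve_from \<gamma> v h)" using t by (auto simp: path_image_def intro!: image_eqI[of _ _ t])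
      then show "p h \<in> path_image (\<gamma> h)" using curve_from(4)[OF w(1,2)] by simp
    qed
    have p_inj: "p h \<noteq> p k" if hk: "h \<in> incident G v" "k \<in> incident G v" "h \<noteq> k" for h k
    proof
      assume eq: "p h = p k"
      obtain w where w: "h \<in> edges G" "ends G h = {v, w}" "other_end G h v = w"
        using incident_ends[OF v hk(1)] by metis
      have "k \<in> edges G" using hk(2) by (simp add: incident_def)
      then have "p h \<in> {v, w}"
        using edges_meet(2)[OF w(1) _ hk(3) p(3)[OF hk(1)]] p(3)[OF hk(2)] eq w(2) by simp
      then show False using p(1,2)[OF hk(1)] r(2)[OF hk(1)] w(3) by auto
    qed
    have ang_pos: "0 < ang h k" if "h \<in> incident G v" "k \<in> incident G v" "h \<noteq> k" for h k
      unfolding ang_def using ccw_angle_pos[OF r(1) p(1) p(1) p_inj] that by metis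
    have ang_inj: "k = l" if "h \<in> incident G v" "k \<in> incident G v" "l \<in> incident G v" "ang h k = ang h l" for h k l
      using ccw_angle_eq_imp_eq[OF r(1) p(1) p(1) p(1), of h k l] p_inj[of k l] that
      unfolding ang_def by metis
    have onC: "h = a \<or> h = b" if h: "h \<in> incident G v" "h \<in> dart_edge ` set ds" for h
    proof -
      obtain h1 h2 where hd: "(h1, h, h2) \<in> set ds" using h(2) edge_of_dart_iff by metis
      then have "v = h1 \<or> v = h2" using cycle_walk_dart[OF cw hd] h(1) by (auto simp: incident_def)
      then show ?thesis using cycle_walk_unique[OF cw hd a] cycle_walk_unique[OF cw hd b] by blast
    qed
    have aC: "a \<in> dart_edge ` set ds" and bC: "b \<in> dart_edge ` set ds"
      unfolding edge_of_dart_iff using a b by metis+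
    have ra: "r < dist v a1" "r < dist v b1" using r(2)[OF aG(3)] r(2)[OF bG(3)] other by auto
    have in_sector: "\<gamma> h ` {0<..<1} \<subseteq> left_side ds"
      if h: "h \<in> incident G v" "h \<notin> dart_edge ` set ds" "ang b h < ang b a" for h
    proof -
      obtain w where w: "h \<in> edges G" "ends G h = {v, w}" "other_end G h v = w"
        using incident_ends[OF v h(1)] by metis
      have "r < dist v w" using r(2)[OF h(1)] w(3) by simp
      moreover have "0 < ang b h" using ang_pos[OF bG(3) h(1)] h(2) bC by blast
      ultimately show ?thesis
        using edge_on_left[OF cw a b w(1,2) h(2) r(1) ra] h(3) unfolding ang_def p_def by blast
    qed
    \<comment> \<open>In the reversed walk \<open>a\<close> leaves \<open>v\<close> and
      \<open>b\<close> enters it, so the sector beyond \<open>a\<close> becomes the left-hand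
      one.\<close>
    have in_sector_reverse: "\<gamma> h ` {0<..<1} \<subseteq> left_side (reverse_walk ds)"
      if h: "h \<in> incident G v" "h \<notin> dart_edge ` set ds" "ang b a < ang b h" for h
    proof -
      obtain w where w: "h \<in> edges G" "ends G h = {v, w}" "other_end G h v = w"
        using incident_ends[OF v h(1)] by metis
      have rw: "r < dist v w" using r(2)[OF h(1)] w(3) by simp
      have pos: "0 < ang a h" using ang_pos[OF aG(3) h(1)] h(2) aC by blast
      have "ang a h = ang b h - ang b a"
        unfolding ang_def using h p(2) aG(3) bG(3)
        by (intro ccw_angle_diff) (auto simp: ang_def)
      moreover have "ang a b = 2 * pi - ang b a"
        using ccw_angle_swap[OF p(2)[OF bG(3)] p(2)[OF aG(3)]] ang_pos[OF bG(3) aG(3)] ab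
        unfolding ang_def by auto
      moreover have "ang b h < 2 * pi" unfolding ang_def by (rule ccw_angle_bounds)
      ultimately have "ang a h < ang a b" by simp
      moreover have "(b1, b, v) \<in> set (reverse_walk ds)" "(v, a, a1) \<in> set (reverse_walk ds)"
        using a b by (simp_all add: dart_in_reverse_walk)
      moreover have "h \<notin> dart_edge ` set (reverse_walk ds)" using h(2) by (simp add: edges_reverse_walk)
      ultimately show ?thesis
        using edge_on_left[OF cycle_walk_reverse[OF cw] _ _ w(1,2) _ r(1) ra(2,1) rw] pos
        unfolding ang_def p_def by blast
    qed
    have key: "0 < ang b (\<sigma> v g) \<and> ang b (\<sigma> v g) \<le> ang b a"
    proof (cases "g = b")
      case True
      \<comment> \<open>The bound on angles alone would admit \<open>b\<close> itself, at angle 0. A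
        fixed point is excluded because \<sigma> acts cyclically on a set that also contains
        \<open>a\<close>.\<close>
      have "\<sigma> v b \<noteq> b"
      proof
        assume fixed: "\<sigma> v b = b"
        have "cyclic_on (\<sigma> v) (incident G v)"
          using rib v bG(3) unfolding ribbon_structure_def by blast
        then have "a \<in> orbit (\<sigma> v) b" using aG(3) bG(3) by (auto simp: cyclic_on_alldef)
        then have "a = b" by (induction rule: orbit.induct) (simp_all add: fixed)
        then show False using ab by simp
      qed
      then show ?thesis
        using ang_pos[OF bG(3) \<sigma>g] ccw_next[OF bG(3), of a] aG(3) ab True by (auto simp: ang_def p_def)
    next
      case False
      have "g \<notin> dart_edge ` set ds \<and> \<gamma> g ` {0<..<1} \<subseteq> left_side ds"
      proof -
        have "(v, g, w) \<notin> set ds" for w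
          using cycle_walk_unique[OF cw b, of v g w] False by auto
        then show ?thesis using left by blast
      qed
      then have gC: "g \<notin> dart_edge ` set ds" and gl: "\<gamma> g ` {0<..<1} \<subseteq> left_side ds" by auto
      have ga: "g \<noteq> a" using gC aC by blast
      \<comment> \<open>Beyond \<open>a\<close> the edge \<open>g\<close> would lie on both sides of
        the cycle. So \<open>g\<close> is in the left-hand sector, and the angle from
        \<open>g\<close> to \<open>a\<close> is a difference of angles from
        \<open>b\<close>.\<close>
      have "\<not> ang b a < ang b g"
      proof
        assume "ang b a < ang b g"
        then have "\<gamma> g ` {0<..<1} \<subseteq> left_side (reverse_walk ds)"
          using in_sector_reverse[OF g gC] by simp
        then have "\<gamma> g ` {0<..<1} = {}" using gl left_side_disjoint_reverse[OF cw] by blast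
        then show False by simp
      qed
      then have "ang g a = ang b a - ang b g"
        unfolding ang_def using g p(2) aG(3) bG(3)
        by (intro ccw_angle_diff) (auto simp: ang_def)
      moreover have "ang g (\<sigma> v g) \<le> ang g a"
        using ccw_next[OF g, of a] aG(3) ga by (auto simp: ang_def p_def)
      moreover have "0 < ang b g" using ang_pos[OF bG(3) g] False by simp
      moreover have "ang b a < 2 * pi" "0 \<le> ang g (\<sigma> v g)" unfolding ang_def by (rule ccw_angle_bounds)+
      \<comment> \<open>The sum is at most the angle from \<open>b\<close> to \<open>a\<close>, so
        it does not wrap around at 2 pi.\<close>
      moreover from calculation have "ang b (\<sigma> v g) = ang b g + ang g (\<sigma> v g)"
        unfolding ang_def using p(2) g bG(3) \<sigma>g by (intro ccw_angle_add) auto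
      ultimately show ?thesis by linarith
    qed
    show ?thesis
    proof (cases "\<sigma> v g = a")
      case True
      then show ?thesis using a by (auto simp: left_half_edges_def)
    next
      case False
      then have "ang b (\<sigma> v g) < ang b a" using key ang_inj[OF bG(3) \<sigma>g aG(3)] by linarith
      moreover have "\<sigma> v g \<noteq> b"
      proof
        assume "\<sigma> v g = b"
        then have "0 < ang b b" using key by simp
        moreover have "ang b b = 0"
          using p(2)[OF bG(3)] Arg2pi_of_real[of 1] by (simp add: ang_def ccw_angle_def)
        ultimately show False by simp
      qed
      then have "\<sigma> v g \<notin> dart_edge ` set ds" using onC[OF \<sigma>g] False by blast
      ultimately show ?thesis using in_sector[OF \<sigma>g] by (simp add: left_half_edges_def)
    qed
  qed
qed

text \<open>A cycle edge other than \<open>f\<close> is a tree edge, so an entering edge is followed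
  back to its tail, where it is the leaving edge and the turn starts in the left-hand sector. An
  edge off the cycle lies on the left as seen from either of its ends, so it does not matter whether
  it is crossed.\<close>

lemma left_half_edges_step:
  assumes cw: "cycle_walk G ds" and ccw: "ccw_ribbon_structure G \<gamma> \<sigma>"
    and T: "dart_edge ` set ds \<subseteq> insert f T"
    and s: "s \<in> half_edges G" "s \<in> left_half_edges ds" "snd s \<noteq> f"
  shows "bernardi_step G \<sigma> T s \<in> left_half_edges ds"
proof -
  obtain v g where vg: "s = (v, g)" by (cases s)
  have v: "v \<in> verts G" and g: "g \<in> incident G v" using s(1) vg by (auto simp: half_edges_def)
  obtain w where w: "g \<in> edges G" "ends G g = {v, w}" "other_end G g v = w" "(w, g) \<in> half_edges G"
    using incident_ends[OF v g] by metis
  then have w': "w \<in> verts G" "g \<in> incident G w" by (auto simp: half_edges_def)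
  show ?thesis
  proof (cases "g \<in> dart_edge ` set ds")
    case True
    then obtain u where u: "(u, g, v) \<in> set ds" using s(2) vg by (auto simp: left_half_edges_def)
    have "g \<in> T" using True T s(3) vg by auto
    moreover have "u = w" using cycle_walk_dart[OF cw u] w(2) by (auto simp: doubleton_eq_iff)
    ultimately show ?thesis
      using left_half_edges_turn[OF cw ccw w'] u w(3) vg
      by (auto simp: bernardi_step_def Let_def)
  next
    case False
    have "(u, g, v) \<notin> set ds" for u
      using False edge_of_dart_iff by metis
    then have "\<gamma> g ` {0<..<1} \<subseteq> left_side ds" using s(2) vg by (auto simp: left_half_edges_def)
    then show ?thesis
      using left_half_edges_turn[OF cw ccw w'] left_half_edges_turn[OF cw ccw v g] False w(3) vg
      by (auto simp: bernardi_step_def Let_def)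
  qed
qed

section \<open>The first visit to \<open>f\<close>, and the choice of orientations\<close>

lemma bernardi_head_eq:
  assumes cw: "cycle_walk G ds" and ccw: "ccw_ribbon_structure G \<gamma> \<sigma>"
    and T: "spanning_tree G T" "dart_edge ` set ds \<subseteq> insert f T"
    and f: "f \<in> dart_edge ` set ds"
    and s: "s \<in> half_edges G" "s \<in> left_half_edges ds"
  shows "bernardi_head G \<sigma> s T f = head_in (set ds) f"
proof -
  have rib: "ribbon_structure G \<sigma>" using ccw by (simp add: ccw_ribbon_structure_def)
  obtain p q where pq: "(p, f, q) \<in> set ds" using f edge_of_dart_iff by metis
  have fE: "f \<in> edges G" and pf: "(p, f) \<in> half_edges G"
    using cycle_walk_dart[OF cw pq] by (auto simp: half_edges_def incident_def)
  let ?st = "bernardi_state G \<sigma> s T"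
  have "\<exists>n. ?st n = (p, f)"
    using bernardi_reaches_tree[OF connected rib T(1) s(1) pf]
    by (simp add: reaches_def bernardi_state_def)
  then have ex: "\<exists>n. snd (?st n) = f" by (metis snd_conv)
  define i where "i = (LEAST n. snd (?st n) = f)"
  have i: "snd (?st i) = f" unfolding i_def using ex by (rule LeastI_ex)
  have before: "snd (?st j) \<noteq> f" if "j < i" for j
    using that not_less_Least unfolding i_def by blast
  have inv: "j \<le> i \<Longrightarrow> ?st j \<in> half_edges G \<and> ?st j \<in> left_half_edges ds" for j
  proof (induction j)
    case (Suc j)
    then show ?case
      using before[of j] left_half_edges_step[OF cw ccw T(2), of "?st j"]
        bernardi_step_half_edges(1)[OF connected rib, of "?st j" T]
      by (simp add: bernardi_state_def)
  qed (use s in \<open>simp add: bernardi_state_def\<close>)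
  \<comment> \<open>The process has not stopped by then: \<open>f\<close> has been met zero times
    before state \<open>i\<close>, not twice.\<close>
  have "bernardi_reached G \<sigma> s T i"
    unfolding bernardi_reached_def
  proof (intro allI impI notI)
    fix n assume n: "n \<le> i" "\<forall>g\<in>edges G. card {j. j < n \<and> snd (?st j) = g} = 2"
    have "{j. j < n \<and> snd (?st j) = f} = {}" using before n(1) by auto
    moreover have "card {j. j < n \<and> snd (?st j) = f} = 2" using n(2) fE by blast
    ultimately show False by (metis card.empty zero_neq_numeral)
  qed
  then have "(LEAST n. bernardi_reached G \<sigma> s T n \<and> snd (?st n) = f) = i"
    using i before by (intro Least_equality) (auto simp: not_less[symmetric])
  then have head: "bernardi_head G \<sigma> s T f = fst (?st i)" by (simp add: bernardi_head_def)
  obtain v where v: "?st i = (v, f)" using i by (cases "?st i") auto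
  \<comment> \<open>As \<open>f\<close> is on the cycle, a left half-edge \<open>(v, f)\<close> can
    only be one at which \<open>f\<close> enters \<open>v\<close>.\<close>
  then obtain u where u: "(u, f, v) \<in> set ds"
    using inv[of i] f by (auto simp: left_half_edges_def)
  have "head_in (set ds) f = v"
    unfolding head_in_def using u cycle_walk_unique[OF cw u] by (intro the_equality) blast+
  then show ?thesis using head v by simp
qed

text \<open>The two orientations of a cycle have opposite sides, and each edge of the cycle enters
  either of its ends in one of them. Hence one orientation suits the starting half-edge.\<close>

lemma ex_orientation:
  assumes C: "is_cycle G C" and e: "e \<in> edges G" "ends G e = {x, y}"
  shows "\<exists>ds. cycle_walk G ds \<and> C = dart_edge ` set ds \<and> (x, e) \<in> left_half_edges ds"
proof -
  obtain ds where ds: "cycle_walk G ds" "C = dart_edge ` set ds" using C by (auto simp: is_cycle_def)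
  note rev = cycle_walk_reverse[OF ds(1)]
  have "(x, e) \<in> left_half_edges ds \<or> (x, e) \<in> left_half_edges (reverse_walk ds)"
  proof (cases "e \<in> C")
    case True
    then obtain p q where pq: "(p, e, q) \<in> set ds" using ds(2) edge_of_dart_iff by metis
    then have "{p, q} = {x, y}" using cycle_walk_dart[OF ds(1) pq] e(2) by simp
    then have "x = q \<or> x = p" by auto
    then show ?thesis
      using pq dart_in_reverse_walk[of q e p ds] by (auto simp: left_half_edges_def)
  next
    case False
    then show ?thesis
      using open_edge_sides[OF ds(1) e(1)] ds(2) edges_reverse_walk[of ds]
      by (auto simp: left_half_edges_def)
  qed
  then show ?thesis using ds rev edges_reverse_walk[of ds] by metis
qed

end

theorem theorem5p1:
  fixes G :: "(complex, 'e) ugraph"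
    and \<gamma> :: "'e \<Rightarrow> real \<Rightarrow> complex"
    and \<sigma> :: "complex \<Rightarrow> 'e \<Rightarrow> 'e"
    and x y :: complex and e :: 'e
  assumes "plane_graph G \<gamma>"
    and "ccw_ribbon_structure G \<gamma> \<sigma>"
    and "e \<in> edges G" and "ends G e = {x, y}"
  shows "\<exists>\<kappa>. cycle_configuration G \<kappa> \<and>
           (\<forall>C. is_cycle G C \<longrightarrow>
              (lies_outside \<gamma> e C \<longrightarrow> clockwise G \<gamma> (\<kappa> C)) \<and>
              (lies_inside \<gamma> e C \<longrightarrow> counter_clockwise G \<gamma> (\<kappa> C)) \<and>
              (e \<in> C \<longrightarrow> (y, e, x) \<in> \<kappa> C)) \<and>
           (\<forall>T. spanning_tree G T \<longrightarrow>
              bernardi_map G \<sigma> (x, e) T = cycle_orientation_map G \<kappa> T)"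
proof -
  interpret plane G \<gamma> by unfold_locales (rule assms(1))
  \<comment> \<open>The orientation depends on the cycle and the starting half-edge only; one walk
    per cycle is fixed before any tree is considered.\<close>
  have "\<forall>C. \<exists>ds. is_cycle G C \<longrightarrow>
      cycle_walk G ds \<and> C = dart_edge ` set ds \<and> (x, e) \<in> left_half_edges ds"
    using ex_orientation assms(3,4) by blast
  then obtain walk where walk: "\<And>C. is_cycle G C \<Longrightarrow>
      cycle_walk G (walk C) \<and> C = dart_edge ` set (walk C) \<and> (x, e) \<in> left_half_edges (walk C)"
    by metis
  define \<kappa> where "\<kappa> C = set (walk C)" for C
  have xe: "(x, e) \<in> half_edges G"
    using assms(3,4) curve_from(7)[OF assms(3,4)] by (auto simp: half_edges_def incident_def)
  have "cycle_configuration G \<kappa>"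
    unfolding cycle_configuration_def orientation_of_def \<kappa>_def using walk by blast
  moreover have "(lies_outside \<gamma> e C \<longrightarrow> clockwise G \<gamma> (\<kappa> C)) \<and>
      (lies_inside \<gamma> e C \<longrightarrow> counter_clockwise G \<gamma> (\<kappa> C)) \<and> (e \<in> C \<longrightarrow> (y, e, x) \<in> \<kappa> C)"
    if C: "is_cycle G C" for C
  proof -
    define ds where "ds = walk C"
    have ds: "cycle_walk G ds" "C = dart_edge ` set ds" "(x, e) \<in> left_half_edges ds"
      using walk[OF C] by (auto simp: ds_def)
    note wp = cycle_walk_path(3)[OF ds(1), folded ds(2)]
    \<comment> \<open>The point at parameter 1/2 serves as a sample of the open edge: it shows on
      which side \<open>e\<close> lies and, when it is off the cycle, that \<open>e\<close> is no
      cycle edge.\<close>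
    have mid: "\<gamma> e (1/2) \<in> \<gamma> e ` {0<..<1}" by auto
    have onC: "(y, e, x) \<in> set ds" if eC: "e \<in> C"
    proof -
      obtain u where u: "(u, e, x) \<in> set ds" using eC ds(2,3) by (auto simp: left_half_edges_def)
      then have "{u, x} = {x, y}" "u \<noteq> x" using cycle_walk_dart[OF ds(1) u] assms(4) by auto
      then have "u = y" by (auto simp: doubleton_eq_iff)
      with u show ?thesis by simp
    qed
    have off: "e \<notin> C" if "\<gamma> e (1/2) \<notin> cycle_image \<gamma> C"
      using that by (auto simp: cycle_image_def path_image_def)
    have left: "\<gamma> e (1/2) \<in> left_side ds" if "e \<notin> C"
    proof -
      have "(u, e, x) \<notin> set ds" for u
        using that ds(2) edge_of_dart_iff by metis
      then show ?thesis using ds(3) mid by (auto simp: left_half_edges_def)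
    qed
    have "clockwise G \<gamma> (set ds)" if out: "lies_outside \<gamma> e C"
    proof -
      have o: "\<gamma> e (1/2) \<in> outside (cycle_image \<gamma> C)" using out mid by (auto simp: lies_outside_def)
      then have "\<gamma> e (1/2) \<in> left_side ds" using left off outside_no_overlap by blast
      \<comment> \<open>A side that contains a point of the outside is not the inside, so of the two
        cases for \<open>left_side\<close> the clockwise one remains.\<close>
      then have "left_side ds \<noteq> inside (cycle_image \<gamma> C)" using o inside_Int_outside by blast
      then have "\<forall>z\<in>inside (cycle_image \<gamma> C). winding_number (walk_path \<gamma> ds) z = - 1"
        by (rule_tac left_side_cases[OF ds(1), folded ds(2)]) auto
      then show ?thesis unfolding clockwise_def wp[symmetric] using ds(1) by blast
    qed
    moreover have "counter_clockwise G \<gamma> (set ds)" if ins: "lies_inside \<gamma> e C"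
    proof -
      have o: "\<gamma> e (1/2) \<in> inside (cycle_image \<gamma> C)" using ins mid by (auto simp: lies_inside_def)
      then have "\<gamma> e (1/2) \<in> left_side ds" using left off inside_no_overlap by blast
      then have "left_side ds \<noteq> outside (cycle_image \<gamma> C)" using o inside_Int_outside by blast
      then have "\<forall>z\<in>inside (cycle_image \<gamma> C). winding_number (walk_path \<gamma> ds) z = 1"
        by (rule_tac left_side_cases[OF ds(1), folded ds(2)]) auto
      then show ?thesis unfolding counter_clockwise_def wp[symmetric] using ds(1) by blast
    qed
    ultimately show ?thesis using onC by (auto simp: \<kappa>_def ds_def)
  qed
  moreover have "bernardi_map G \<sigma> (x, e) T = cycle_orientation_map G \<kappa> T" if T: "spanning_tree G T" for T
  proof -
    have "bernardi_head G \<sigma> (x, e) T f = head_in (\<kappa> (fundamental_cycle G T f)) f"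
      if f: "f \<in> edges G - T" for f
    proof -
      note fc = fundamental_cycle[OF connected T f]
      define ds where "ds = walk (fundamental_cycle G T f)"
      have ds: "cycle_walk G ds" "fundamental_cycle G T f = dart_edge ` set ds"
        "(x, e) \<in> left_half_edges ds"
        using walk[OF fc(1)] by (auto simp: ds_def)
      have "bernardi_head G \<sigma> (x, e) T f = head_in (set ds) f"
        by (rule bernardi_head_eq[OF ds(1) assms(2) T _ _ xe ds(3)]) (use fc(2,3) in \<open>simp_all only: ds(2)\<close>)
      then show ?thesis by (simp add: \<kappa>_def ds_def)
    qed
    then show ?thesis
      unfolding bernardi_map_def cycle_orientation_map_def chips_def by (intro ext sum.cong) auto
  qed
  ultimately show ?thesis by blast
qed

end
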